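(* Let $\omega$ be a homeomorphism of a compact metric space $\Theta$, let $X=[a,b]\subset\mathbb{R}$, and suppose that $(f_\beta)_{\beta\in[0,1]}$ is a parameter family of $\omega$-forced monotone $C^2$-interval maps $f_\beta(\theta,x)=(\omega(\theta),f_{\beta,\theta}(x))$ on $\Theta\times X$. Assume that there exist continuous functions $\gamma^-,\gamma^+:\Theta\to X$ with $\gamma^-<\gamma^+$ such that, with $\Gamma_\theta=[\gamma^-(\theta),\gamma^+(\theta)]$ and $\Gamma=\{(\theta,x)\in\Theta\times X : x\in\Gamma_\theta\}$, the following hold (for all $\beta\in[0,1]$ and $\theta\in\Theta$ where applicable): (d1) there exist two distinct continuous $f_0$-invariant graphs in $\Gamma$ and no $f_1$-invariant graph in $\Gamma$; (d2) $f_{\beta,\theta}(\gamma^-(\theta))\ge\gamma^-(\omega(\theta))$ and $f_{\beta,\theta}(\gamma^+(\theta))\ge\gamma^+(\omega(\theta))$; (d3) the maps $(\beta,\theta,x)\mapsto\partial_x^i f_{\beta,\theta}(x)$ with $i=0,1,2$ and $(\beta,\theta,x)\mapsto\partial_\beta f_{\beta,\theta}(x)$ are continuous; (d4) $f'_{\beta,\theta}(x)>0$ for all $x\in\Gamma_\theta$; (d5) $\partial_\beta f_{\beta,\theta}(x)>0$ for all $x\in\Gamma_\theta$; (d6) $f''_{\beta,\theta}(x)>0$ for all $x\in\Gamma_\theta$. Then there exists a unique critical parameter $\beta_c\in(0,1)$ such that: (1) If $\beta<\beta_c$, then there exist two continuous $f_\beta$-invariant graphs $\varphi^-_\beta<\varphi^+_\beta$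 in $\Gamma$. For any $\omega$-invariant measure $\mu$ we have $\lambda_\mu(\varphi^-_\beta)<0$ and $\lambda_\mu(\varphi^+_\beta)>0$. (2) If $\beta=\beta_c$, then either there exists exactly one continuous $f_\beta$-invariant graph $\varphi_\beta$ in $\Gamma$, or there exist two semi-continuous and weakly pinched $f_\beta$-invariant graphs $\varphi^-_\beta\le\varphi^+_\beta$ in $\Gamma$, with $\varphi^-_\beta$ lower and $\varphi^+_\beta$ upper semi-continuous. If $\mu$ is an $\omega$-invariant measure, then in the first case $\lambda_\mu(\varphi_\beta)=0$. In the second case, $\varphi^-_\beta(\theta)=\varphi^+_\beta(\theta)$ $\mu$-a.s. implies $\lambda_\mu(\varphi^-_\beta)=\lambda_\mu(\varphi^+_\beta)=0$, whereas $\varphi^-_\beta(\theta)<\varphi^+_\beta(\theta)$ $\mu$-a.s. implies $\lambda_\mu(\varphi^-_\beta)<0$ and $\lambda_\mu(\varphi^+_\beta)>0$. (3) If $\beta>\beta_c$, then no $f_\beta$-invariant graphs exist in $\Gamma$.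
   Context: Measures are Borel probability measures. An $\omega$-forced monotone $C^r$-interval map is a map $f:\Theta\times X\to\Theta\times X$, $f(\theta,x)=(\omega(\theta),f_\theta(x))$, with $X=[a,b]$ a compact interval, such that all fibre maps $f_\theta:X\to X$ are $r$ times continuously differentiable and strictly increasing, and all derivatives $f_\theta^{(k)}(x)$, $k=0,\ldots,r$, depend continuously on $(\theta,x)$. Primes denote derivatives with respect to $x$. An $f$-invariant graph is a measurable function $\varphi:\Theta\to X$, defined everywhere, with $f_\theta(\varphi(\theta))=\varphi(\omega(\theta))$ for all $\theta\in\Theta$. It is in $\Gamma$ if $\varphi(\theta)\in\Gamma_\theta$ for all $\theta\in\Theta$. For an $\omega$-invariant measure $\mu$, the Lyapunov exponent of an $f_\beta$-invariant graph $\varphi$ is $\lambda_\mu(\varphi)=\int_\Theta\log f'_{\beta,\theta}(\varphi(\theta))\,d\mu(\theta)$. If $\varphi^-\le\varphi^+:\Theta\to X$ with $\varphi^-$ lower semi-continuous and $\varphi^+$ upper semi-continuous, then $\varphi^-$ and $\varphi^+$ are called weakly pinched if $\inf_{\theta\in\Theta}(\varphi^+(\theta)-\varphi^-(\theta))=0$.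
   Formalization: In (d1) "distinct" means the two graphs differ at every θ (false if they may touch: x+(x²-θ²)/10+β, ω=id); in (2) the first case means the continuous graph is the only invariant graph in Γ, not merely the only continuous one. *)

theory Defs
  imports "HOL-Analysis.Analysis" "HOL-Probability.Probability"
begin

(* The base space Theta is the whole type 'a; compactness of UNIV is assumed in the theorem.
   A forced map F is a total function on pairs, of which only the values on UNIV \<times> X matter. *)

definition fibre :: "('a \<times> real \<Rightarrow> 'a \<times> real) \<Rightarrow> 'a \<Rightarrow> real \<Rightarrow> real" where
  "fibre F \<theta> x = snd (F (\<theta>, x))"

(* k-th derivative relative to S. For x in a nondegenerate interval S it depends only on the values
   of g on S; at the end points it is the one-sided derivative. It is meaningful only
   where the preceding derivatives are differentiable, which is required separately. *)
primrec deriv_on :: "real set \<Rightarrow> nat \<Rightarrow> (real \<Rightarrow> real) \<Rightarrow> real \<Rightarrow> real" where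
  "deriv_on S 0 g = g"
| "deriv_on S (Suc k) g = (\<lambda>x. vector_derivative (deriv_on S k g) (at x within S))"

definition forced_monotone_map ::
  "real set \<Rightarrow> nat \<Rightarrow> ('a::metric_space \<Rightarrow> 'a) \<Rightarrow> ('a \<times> real \<Rightarrow> 'a \<times> real) \<Rightarrow> bool" where
  "forced_monotone_map X r \<omega> F \<longleftrightarrow>
     (\<forall>\<theta>. \<forall>x\<in>X. fst (F (\<theta>, x)) = \<omega> \<theta> \<and> fibre F \<theta> x \<in> X) \<and>
     (\<forall>\<theta>. strict_mono_on X (fibre F \<theta>)) \<and>
     (\<forall>k<r. \<forall>\<theta>. \<forall>x\<in>X. deriv_on X k (fibre F \<theta>) differentiable (at x within X)) \<and>
     (\<forall>k\<le>r. continuous_on (UNIV \<times> X) (\<lambda>(\<theta>, x). deriv_on X k (fibre F \<theta>) x))"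

definition invariant_graph ::
  "real set \<Rightarrow> ('a::metric_space \<Rightarrow> 'a) \<Rightarrow> ('a \<times> real \<Rightarrow> 'a \<times> real) \<Rightarrow> ('a \<Rightarrow> real) \<Rightarrow> bool" where
  "invariant_graph X \<omega> F \<phi> \<longleftrightarrow>
     \<phi> \<in> borel_measurable borel \<and> (\<forall>\<theta>. \<phi> \<theta> \<in> X) \<and> (\<forall>\<theta>. fibre F \<theta> (\<phi> \<theta>) = \<phi> (\<omega> \<theta>))"

definition region :: "('a \<Rightarrow> real) \<Rightarrow> ('a \<Rightarrow> real) \<Rightarrow> ('a \<times> real) set" where
  "region \<gamma>m \<gamma>p = {(\<theta>, x). x \<in> {\<gamma>m \<theta>..\<gamma>p \<theta>}}"

definition invariant_graph_in ::
  "('a \<times> real) set \<Rightarrow> real set \<Rightarrow> ('a::metric_space \<Rightarrow> 'a) \<Rightarrow> ('a \<times> real \<Rightarrow> 'a \<times> real) \<Rightarrow> ('a \<Rightarrow> real) \<Rightarrow> bool" where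
  "invariant_graph_in \<Gamma> X \<omega> F \<phi> \<longleftrightarrow> invariant_graph X \<omega> F \<phi> \<and> (\<forall>\<theta>. (\<theta>, \<phi> \<theta>) \<in> \<Gamma>)"

definition invariant_measure :: "('a::metric_space \<Rightarrow> 'a) \<Rightarrow> 'a measure \<Rightarrow> bool" where
  "invariant_measure \<omega> \<mu> \<longleftrightarrow> prob_space \<mu> \<and> sets \<mu> = sets borel \<and> distr \<mu> borel \<omega> = \<mu>"

definition lyapunov_exponent ::
  "real set \<Rightarrow> ('a \<times> real \<Rightarrow> 'a \<times> real) \<Rightarrow> 'a measure \<Rightarrow> ('a \<Rightarrow> real) \<Rightarrow> real" where
  "lyapunov_exponent X F \<mu> \<phi> = (\<integral>\<theta>. ln (deriv_on X 1 (fibre F \<theta>) (\<phi> \<theta>)) \<partial>\<mu>)"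

definition lower_semicont :: "('a::topological_space \<Rightarrow> real) \<Rightarrow> bool" where
  "lower_semicont \<phi> \<longleftrightarrow> (\<forall>c. open {\<theta>. c < \<phi> \<theta>})"

definition upper_semicont :: "('a::topological_space \<Rightarrow> real) \<Rightarrow> bool" where
  "upper_semicont \<phi> \<longleftrightarrow> (\<forall>c. open {\<theta>. \<phi> \<theta> < c})"

definition weakly_pinched :: "('a::topological_space \<Rightarrow> real) \<Rightarrow> ('a \<Rightarrow> real) \<Rightarrow> bool" where
  "weakly_pinched \<phi>m \<phi>p \<longleftrightarrow>
     (\<forall>\<theta>. \<phi>m \<theta> \<le> \<phi>p \<theta>) \<and> lower_semicont \<phi>m \<and> upper_semicont \<phi>p \<and>
     (INF \<theta>. \<phi>p \<theta> - \<phi>m \<theta>) = 0"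

end

theory Submission
  imports Defs
begin

text \<open>
  Fix a parameter and suppose that the map has an invariant graph in the region. The lower boundary
  curve is mapped above itself, so its forward iterates increase; they stay below every invariant
  graph and converge to the smallest one, \<open>\<phi>m\<close>, which is lower semicontinuous. The upper boundary
  curve is also mapped above itself, so its preimages decrease to the largest invariant graph
  \<open>\<phi>p\<close>, which is upper semicontinuous. Call a curve \<open>\<xi>\<close> with \<open>f(\<xi>) + c \<le> \<xi> \<circ> \<omega>\<close> a
  \<open>supersolution\<close>; if \<open>c \<ge> 0\<close> it lies between \<open>\<phi>m\<close> and \<open>\<phi>p\<close>, and its mere existence keeps the
  iterates of the lower boundary in the region and thus yields an invariant graph.

  Let \<open>S\<close> be the set of parameters with an invariant graph. A supersolution for a parameter is one
  with positive margin for every smaller parameter, because the fibre maps increase with the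
  parameter; so \<open>S\<close> is an initial segment of the unit interval. It is closed, since it is
  described by the inequalities saying that the finitely iterated lower boundary stays below the
  upper one. If two invariant graphs have distance bounded away from zero, then by strict convexity
  their average is a supersolution with positive margin, and such a curve remains a supersolution
  for slightly larger parameters (\<open>midpoint_supersolution\<close>,
  \<open>feasible_beyond_strict_supersolution\<close>). Applied at \<open>0\<close> this shows that the maximum \<open>\<beta>c\<close> of \<open>S\<close>
  is positive; applied at \<open>\<beta>c\<close> it shows that the gap between \<open>\<phi>m\<close> and \<open>\<phi>p\<close> has infimum zero there.

  Below \<open>\<beta>c\<close> there is a supersolution \<open>\<xi>\<close> with positive margin. Comparing the tangent of the fibre
  map at \<open>\<phi>m\<close> with the increment from \<open>\<phi>m\<close> to \<open>\<xi>\<close> shows that the map contracts uniformly in the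
  distance measured relative to \<open>\<xi> - \<phi>m\<close>. By convexity the contraction is even stronger below
  \<open>\<phi>m\<close>, so the iterates of the lower boundary converge uniformly and \<open>\<phi>m\<close> is continuous; likewise
  for \<open>\<phi>p\<close> and preimages (\<open>lower_graph_cont\<close>, \<open>upper_graph_cont\<close>).

  The signs of the exponents come from comparing slopes. Where \<open>\<phi>m < \<phi>p\<close>, the chord slope
  \<open>(\<phi>p - \<phi>m)(\<omega> \<theta>) / (\<phi>p - \<phi>m)(\<theta>)\<close> lies strictly between the tangent slopes at \<open>\<phi>m\<close> and \<open>\<phi>p\<close>, and
  its logarithm is a coboundary with integral zero (\<open>integral_coboundary_eq_0\<close>,
  \<open>lyapunov_signs\<close>). Where the graphs coincide almost everywhere, the exponents agree, and letting
  the parameter increase to \<open>\<beta>c\<close> shows that the common value is neither positive nor negative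
  (\<open>lyapunov_limit_signs\<close>).
\<close>

section \<open>Semicontinuity, compactness and coboundaries\<close>

lemma continuous_if_semicont:
  assumes "lower_semicont u" "upper_semicont u"
  shows "continuous_on UNIV u"
proof -
  have "(u \<longlongrightarrow> u x) (at x)" for x
  proof (rule order_tendstoI)
    fix c assume c: "c < u x"
    have "open {y. c < u y}" using assms(1) by (simp add: lower_semicont_def)
    then show "\<forall>\<^sub>F y in at x. c < u y"
      using c by (auto simp: eventually_at_topological)
  next
    fix c assume c: "u x < c"
    have "open {y. u y < c}" using assms(2) by (simp add: upper_semicont_def)
    then show "\<forall>\<^sub>F y in at x. u y < c"
      using c by (auto simp: eventually_at_topological)
  qed
  then show ?thesis by (simp add: continuous_on_def)
qed

text \<open>
  A criterion for functions known only implicitly, through the comparison of their values with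
  constants. Levels outside the range \<open>{a..b}\<close> are harmless, which matters because the implicit
  description is meaningful only inside it.
\<close>

lemma continuous_if_levels_open:
  fixes u :: "'c::topological_space \<Rightarrow> real"
  assumes "\<And>x. u x \<in> {a..b}"
    and "\<And>c. c \<in> {a..b} \<Longrightarrow> open {x. c < u x}" "\<And>c. c \<in> {a..b} \<Longrightarrow> open {x. u x < c}"
  shows "continuous_on UNIV u"
proof (rule continuous_if_semicont; unfold lower_semicont_def upper_semicont_def; rule allI)
  have range: "a \<le> u x" "u x \<le> b" for x using assms(1)[of x] by auto
  fix c :: real
  consider "c < a" | "b < c" | "c \<in> {a..b}" by fastforce
  then show "open {x. c < u x}"
  proof cases
    case 1
    then have "{x. c < u x} = UNIV" by (auto intro: less_le_trans range)
    then show ?thesis by simp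
  next
    case 2
    then have "{x. c < u x} = {}" using range(2) by (auto simp: not_less intro: order_trans less_imp_le)
    then show ?thesis by simp
  qed (rule assms(2))
  consider "c < a" | "b < c" | "c \<in> {a..b}" by fastforce
  then show "open {x. u x < c}"
  proof cases
    case 1
    then have "{x. u x < c} = {}" using range(1) by (auto simp: not_less intro: order_trans less_imp_le)
    then show ?thesis by simp
  next
    case 2
    then have "{x. u x < c} = UNIV" by (auto intro: le_less_trans range)
    then show ?thesis by simp
  qed (rule assms(3))
qed

lemma lower_semicont_limit_from_below:
  assumes "\<And>n. continuous_on UNIV (u n)" "\<And>n \<theta>. u n \<theta> \<le> v \<theta>" "\<And>\<theta>. (\<lambda>n. u n \<theta>) \<longlonglongrightarrow> v \<theta>"
  shows "lower_semicont v"
  unfolding lower_semicont_def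
proof
  fix c
  have "{\<theta>. c < v \<theta>} = (\<Union>n. {\<theta>. c < u n \<theta>})"
  proof (intro set_eqI iffI)
    fix \<theta> assume "\<theta> \<in> {\<theta>. c < v \<theta>}"
    then have "\<forall>\<^sub>F n in sequentially. c < u n \<theta>"
      using order_tendstoD(1)[OF assms(3)] by simp
    then obtain n where "c < u n \<theta>" by (auto simp: eventually_sequentially)
    then show "\<theta> \<in> (\<Union>n. {\<theta>. c < u n \<theta>})" by blast
  next
    fix \<theta> assume "\<theta> \<in> (\<Union>n. {\<theta>. c < u n \<theta>})"
    then obtain n where "c < u n \<theta>" by blast
    also have "\<dots> \<le> v \<theta>" by (rule assms(2))
    finally show "\<theta> \<in> {\<theta>. c < v \<theta>}" by simp
  qed
  then show "open {\<theta>. c < v \<theta>}"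
    by (simp only:) (intro open_UN ballI open_Collect_less continuous_on_const assms(1))
qed

lemma upper_semicont_limit_from_above:
  assumes "\<And>n. continuous_on UNIV (u n)" "\<And>n \<theta>. v \<theta> \<le> u n \<theta>" "\<And>\<theta>. (\<lambda>n. u n \<theta>) \<longlonglongrightarrow> v \<theta>"
  shows "upper_semicont v"
proof -
  have "lower_semicont (\<lambda>\<theta>. - v \<theta>)"
    by (rule lower_semicont_limit_from_below[of "\<lambda>n \<theta>. - u n \<theta>"])
      (use assms in \<open>auto intro: continuous_on_minus tendsto_minus\<close>)
  then have "open {\<theta>. - c < - v \<theta>}" for c
    unfolding lower_semicont_def by blast
  then show ?thesis by (simp add: upper_semicont_def)
qed

lemma continuous_geometric_limit:
  fixes u :: "nat \<Rightarrow> 'c::topological_space \<Rightarrow> real"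
  assumes "\<And>n. continuous_on UNIV (u n)" "\<And>n x. \<bar>u n x - v x\<bar> \<le> A * \<kappa> ^ n" "0 \<le> \<kappa>" "\<kappa> < 1"
  shows "continuous_on UNIV v"
proof -
  have "uniform_limit UNIV u v sequentially"
  proof (rule uniform_limitI)
    fix e :: real assume e: "0 < e"
    have "(\<lambda>n. A * \<kappa> ^ n) \<longlonglongrightarrow> A * 0"
      using assms(3,4) by (intro tendsto_mult tendsto_const LIMSEQ_power_zero) auto
    then have "\<forall>\<^sub>F n in sequentially. A * \<kappa> ^ n < e"
      using e by (intro order_tendstoD) auto
    then show "\<forall>\<^sub>F n in sequentially. \<forall>x\<in>UNIV. dist (u n x) (v x) < e"
      by eventually_elim (auto simp: dist_real_def intro: le_less_trans[OF assms(2)])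
  qed
  then show ?thesis
    by (rule uniform_limit_theorem[rotated]) (auto simp: assms(1))
qed

lemma compact_abs_bound:
  fixes h :: "'c::topological_space \<Rightarrow> real"
  assumes "compact K" "continuous_on K h"
  shows "\<exists>C. \<forall>z\<in>K. \<bar>h z\<bar> \<le> C"
  using compact_imp_bounded[OF compact_continuous_image[OF assms(2,1)]]
  unfolding bounded_iff real_norm_def by blast

lemma compact_positive_bound:
  fixes h :: "'c::topological_space \<Rightarrow> real"
  assumes "compact K" "continuous_on K h" "\<And>z. z \<in> K \<Longrightarrow> 0 < h z"
  shows "\<exists>c>0. \<forall>z\<in>K. c \<le> h z"
proof (cases "K = {}")
  case True
  then show ?thesis by (auto intro: exI[of _ 1])
next
  case False
  then obtain z where "z \<in> K" "\<forall>y\<in>K. h z \<le> h y"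
    using continuous_attains_inf[OF assms(1) _ assms(2)] by blast
  then show ?thesis using assms(3) by blast
qed

text \<open>
  The function \<open>h\<close> need not be integrable, so its integral cannot simply be cancelled. The
  truncations of \<open>h\<close> are integrable, their coboundaries are dominated by that of \<open>h\<close> because
  truncation is a contraction, and the coboundary of each truncation has integral zero by
  invariance.
\<close>

lemma integral_coboundary_eq_0:
  fixes h :: "'a::metric_space \<Rightarrow> real"
  assumes inv: "invariant_measure \<omega> \<mu>" and \<omega>: "continuous_on UNIV \<omega>"
    and h: "h \<in> borel_measurable borel" and bound: "AE \<theta> in \<mu>. \<bar>h (\<omega> \<theta>) - h \<theta>\<bar> \<le> C"
  shows "integrable \<mu> (\<lambda>\<theta>. h (\<omega> \<theta>) - h \<theta>)" and "(\<integral>\<theta>. h (\<omega> \<theta>) - h \<theta> \<partial>\<mu>) = 0"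
proof -
  interpret prob_space \<mu> using inv by (simp add: invariant_measure_def)
  have sets: "sets \<mu> = sets borel" and distr: "distr \<mu> borel \<omega> = \<mu>"
    using inv by (auto simp: invariant_measure_def)
  have \<omega>b: "\<omega> \<in> borel_measurable borel"
    using \<omega> by (rule borel_measurable_continuous_onI)
  have \<omega>m: "\<omega> \<in> measurable \<mu> borel"
    using \<omega>b sets measurable_cong_sets[OF sets refl] by blast
  have hm: "h \<in> borel_measurable \<mu>"
    using h sets measurable_cong_sets[OF sets refl] by blast
  have h\<omega>m: "(\<lambda>\<theta>. h (\<omega> \<theta>)) \<in> borel_measurable \<mu>"
    using measurable_compose[OF \<omega>m h] .
  show int: "integrable \<mu> (\<lambda>\<theta>. h (\<omega> \<theta>) - h \<theta>)"
    using bound hm h\<omega>m by (intro integrable_const_bound[where B = C]) auto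
  define s where "s = (\<lambda>(n::nat) \<theta>. max (- real n) (min (h \<theta>) (real n)))"
  have s_bound: "\<bar>s n \<theta>\<bar> \<le> real n" for n \<theta> unfolding s_def by linarith
  have s_contr: "\<bar>s n \<eta> - s n \<theta>\<bar> \<le> \<bar>h \<eta> - h \<theta>\<bar>" for n \<eta> \<theta>
  proof -
    have 1: "\<bar>max c x - max c y\<bar> \<le> \<bar>x - y\<bar>" for c x y :: real by linarith
    have 2: "\<bar>min x c - min y c\<bar> \<le> \<bar>x - y\<bar>" for c x y :: real by linarith
    show ?thesis unfolding s_def by (rule order_trans[OF 1 2])
  qed
  have sb: "s n \<in> borel_measurable borel" for n
    using h unfolding s_def by measurable
  have sm: "s n \<in> borel_measurable \<mu>" for n
    using sb sets measurable_cong_sets[OF sets refl] by blast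
  have s\<omega>m: "(\<lambda>\<theta>. s n (\<omega> \<theta>)) \<in> borel_measurable \<mu>" for n
    using measurable_compose[OF \<omega>m sb] .
  have s_int: "integrable \<mu> (s n)" for n
    using sm by (intro integrable_const_bound[where B = "real n"]) (simp_all add: s_bound)
  have s\<omega>_int: "integrable \<mu> (\<lambda>\<theta>. s n (\<omega> \<theta>))" for n
    using s\<omega>m by (intro integrable_const_bound[where B = "real n"]) (simp_all add: s_bound)
  have zero: "(\<integral>\<theta>. s n (\<omega> \<theta>) - s n \<theta> \<partial>\<mu>) = 0" for n
  proof -
    have "(\<integral>\<theta>. s n (\<omega> \<theta>) \<partial>\<mu>) = (\<integral>\<theta>. s n \<theta> \<partial>distr \<mu> borel \<omega>)"
      using integral_distr[OF \<omega>m sb] by simp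
    then show ?thesis using s_int s\<omega>_int distr by simp
  qed
  have "(\<lambda>n. \<integral>\<theta>. s n (\<omega> \<theta>) - s n \<theta> \<partial>\<mu>) \<longlonglongrightarrow> (\<integral>\<theta>. h (\<omega> \<theta>) - h \<theta> \<partial>\<mu>)"
  proof (rule integral_dominated_convergence[where w = "\<lambda>_. C"])
    have s_lim: "(\<lambda>n. s n \<theta>) \<longlonglongrightarrow> h \<theta>" for \<theta>
    proof -
      obtain N where N: "\<bar>h \<theta>\<bar> \<le> real N" using real_arch_simple by blast
      have "s n \<theta> = h \<theta>" if "n \<ge> N" for n
        using N of_nat_mono[OF that, where 'a = real] unfolding s_def by linarith
      then have "\<forall>\<^sub>F n in sequentially. s n \<theta> = h \<theta>"
        by (auto simp: eventually_sequentially)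
      then show ?thesis by (rule tendsto_eventually)
    qed
    show "AE \<theta> in \<mu>. (\<lambda>n. s n (\<omega> \<theta>) - s n \<theta>) \<longlonglongrightarrow> h (\<omega> \<theta>) - h \<theta>"
      by (intro always_eventually allI tendsto_diff s_lim)
    show "AE \<theta> in \<mu>. norm (s n (\<omega> \<theta>) - s n \<theta>) \<le> C" for n
      using bound by eventually_elim (simp only: real_norm_def, rule order_trans[OF s_contr])
  qed (use sm s\<omega>m hm h\<omega>m in auto)
  then show "(\<integral>\<theta>. h (\<omega> \<theta>) - h \<theta> \<partial>\<mu>) = 0"
    unfolding zero by (simp add: LIMSEQ_const_iff)
qed

section \<open>Iterating the boundary curves of a convex forced map\<close>

text \<open>
  Pushing a curve forward: the iterate at \<open>\<theta>\<close> is the image of the point of the curve over the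
  preimage \<open>\<omega>' \<theta>\<close>, so \<open>\<omega>'\<close> is meant to be the inverse of \<open>\<omega>\<close>.
\<close>

primrec lower_iterate ::
  "('a \<Rightarrow> 'a) \<Rightarrow> ('a \<Rightarrow> real \<Rightarrow> real) \<Rightarrow> ('a \<Rightarrow> real) \<Rightarrow> nat \<Rightarrow> 'a \<Rightarrow> real" where
  "lower_iterate \<omega>' g \<gamma> 0 = \<gamma>"
| "lower_iterate \<omega>' g \<gamma> (Suc n) = (\<lambda>\<theta>. g (\<omega>' \<theta>) (lower_iterate \<omega>' g \<gamma> n (\<omega>' \<theta>)))"

text \<open>
  Pulling a curve back under the fibre maps. The inverse is the intended one only if the curve
  lies in the image of the fibre maps; for the curves used below this is guaranteed by an
  invariant graph beneath them together with the hypothesis on the upper boundary.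
\<close>

primrec upper_iterate ::
  "('a \<Rightarrow> 'a) \<Rightarrow> real set \<Rightarrow> ('a \<Rightarrow> real \<Rightarrow> real) \<Rightarrow> ('a \<Rightarrow> real) \<Rightarrow> nat \<Rightarrow> 'a \<Rightarrow> real" where
  "upper_iterate \<omega> X g \<gamma> 0 = \<gamma>"
| "upper_iterate \<omega> X g \<gamma> (Suc n) = (\<lambda>\<theta>. the_inv_into X (g \<theta>) (upper_iterate \<omega> X g \<gamma> n (\<omega> \<theta>)))"

definition lower_graph where
  "lower_graph \<omega>' g \<gamma> \<theta> = (SUP n. lower_iterate \<omega>' g \<gamma> n \<theta>)"

definition upper_graph where
  "upper_graph \<omega> X g \<gamma> \<theta> = (INF n. upper_iterate \<omega> X g \<gamma> n \<theta>)"

text \<open>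
  A curve that the map sends below itself with margin \<open>c\<close>. The definition is pointwise, so that
  invariant graphs of other parameters and averages of semicontinuous graphs qualify. Curves with
  \<open>c = 0\<close> serve as barriers between the two extremal invariant graphs; a margin \<open>c > 0\<close> forces
  these graphs to be continuous.
\<close>

definition supersolution ::
  "('a \<Rightarrow> 'a) \<Rightarrow> ('a \<Rightarrow> real \<Rightarrow> real) \<Rightarrow> ('a \<Rightarrow> real) \<Rightarrow> ('a \<Rightarrow> real) \<Rightarrow> real \<Rightarrow> ('a \<Rightarrow> real) \<Rightarrow> bool" where
  "supersolution \<omega> g \<gamma>m \<gamma>p c \<xi> \<longleftrightarrow>
     (\<forall>\<theta>. \<gamma>m \<theta> \<le> \<xi> \<theta> \<and> \<xi> \<theta> \<le> \<gamma>p \<theta> \<and> g \<theta> (\<xi> \<theta>) + c \<le> \<xi> (\<omega> \<theta>))"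

text \<open>
  One forced map, given by its fibre maps \<open>g \<theta>\<close> and their slopes \<open>dg \<theta>\<close>. Strict convexity
  enters as the statement that within the region the graph of a fibre map lies strictly above its
  tangents; this single
  inequality controls increments from both ends and so replaces all second derivatives.
\<close>

locale convex_forced =
  fixes \<omega> \<omega>' :: "'a::metric_space \<Rightarrow> 'a" and a b :: real
    and g dg :: "'a \<Rightarrow> real \<Rightarrow> real" and \<gamma>m \<gamma>p :: "'a \<Rightarrow> real"
  assumes compact_base: "compact (UNIV :: 'a set)"
    and \<omega>_cont: "continuous_on UNIV \<omega>" and \<omega>'_cont: "continuous_on UNIV \<omega>'"
    and \<omega>\<omega>' [simp]: "\<omega> (\<omega>' \<theta>) = \<theta>" and \<omega>'\<omega> [simp]: "\<omega>' (\<omega> \<theta>) = \<theta>"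
    and g_cont: "continuous_on (UNIV \<times> {a..b}) (\<lambda>(\<theta>, x). g \<theta> x)"
    and dg_cont: "continuous_on (UNIV \<times> {a..b}) (\<lambda>(\<theta>, x). dg \<theta> x)"
    and g_in: "x \<in> {a..b} \<Longrightarrow> g \<theta> x \<in> {a..b}"
    and g_strict_mono: "x \<in> {a..b} \<Longrightarrow> y \<in> {a..b} \<Longrightarrow> x < y \<Longrightarrow> g \<theta> x < g \<theta> y"
    and \<gamma>m_cont: "continuous_on UNIV \<gamma>m" and \<gamma>p_cont: "continuous_on UNIV \<gamma>p"
    and \<gamma>m_in: "\<gamma>m \<theta> \<in> {a..b}" and \<gamma>p_in: "\<gamma>p \<theta> \<in> {a..b}"
    and \<gamma>_less: "\<gamma>m \<theta> < \<gamma>p \<theta>"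
    and dg_pos: "\<gamma>m \<theta> \<le> x \<Longrightarrow> x \<le> \<gamma>p \<theta> \<Longrightarrow> 0 < dg \<theta> x"
    and tangent: "\<gamma>m \<theta> \<le> x \<Longrightarrow> x \<le> \<gamma>p \<theta> \<Longrightarrow> \<gamma>m \<theta> \<le> y \<Longrightarrow> y \<le> \<gamma>p \<theta> \<Longrightarrow> x \<noteq> y \<Longrightarrow>
      g \<theta> x + dg \<theta> x * (y - x) < g \<theta> y"
    and \<gamma>m_up: "\<gamma>m (\<omega> \<theta>) \<le> g \<theta> (\<gamma>m \<theta>)" and \<gamma>p_up: "\<gamma>p (\<omega> \<theta>) \<le> g \<theta> (\<gamma>p \<theta>)"
begin

abbreviation "lo \<equiv> lower_iterate \<omega>' g \<gamma>m"
abbreviation "up \<equiv> upper_iterate \<omega> {a..b} g \<gamma>p"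
abbreviation "\<phi>m \<equiv> lower_graph \<omega>' g \<gamma>m"
abbreviation "\<phi>p \<equiv> upper_graph \<omega> {a..b} g \<gamma>p"
abbreviation "super \<equiv> supersolution \<omega> g \<gamma>m \<gamma>p"

lemma in_range: "\<gamma>m \<theta> \<le> x \<Longrightarrow> x \<le> \<gamma>p \<theta> \<Longrightarrow> x \<in> {a..b}"
  using \<gamma>m_in[of \<theta>] \<gamma>p_in[of \<theta>] by auto

lemma range_ge: "\<gamma>m \<theta> \<le> x \<Longrightarrow> a \<le> x" and range_le: "x \<le> \<gamma>p \<theta> \<Longrightarrow> x \<le> b"
  using \<gamma>m_in[of \<theta>] \<gamma>p_in[of \<theta>] by auto

lemma g_mono: "x \<in> {a..b} \<Longrightarrow> y \<in> {a..b} \<Longrightarrow> x \<le> y \<Longrightarrow> g \<theta> x \<le> g \<theta> y"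
  using g_strict_mono[of x y \<theta>] by (cases "x = y") auto

lemma g_inj: "inj_on (g \<theta>) {a..b}"
  by (rule linorder_inj_onI) (metis g_strict_mono less_irrefl, auto)

lemma g_fibre_cont: "continuous_on {a..b} (g \<theta>)"
  by (rule continuous_on_compose2[OF g_cont, of "{a..b}" "\<lambda>x. (\<theta>, x)", simplified])
     (auto intro!: continuous_intros)

lemma tangent_le:
  "\<gamma>m \<theta> \<le> x \<Longrightarrow> x \<le> \<gamma>p \<theta> \<Longrightarrow> \<gamma>m \<theta> \<le> y \<Longrightarrow> y \<le> \<gamma>p \<theta> \<Longrightarrow> dg \<theta> x * (y - x) \<le> g \<theta> y - g \<theta> x"
  using tangent[of \<theta> x y] by (cases "x = y") auto

lemma continuous_along_curve:
  assumes h: "continuous_on (UNIV \<times> {a..b}) (\<lambda>(\<theta>, x). h \<theta> x)"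
    and u: "continuous_on UNIV u" "\<And>\<theta>. u \<theta> \<in> {a..b}"
  shows "continuous_on UNIV (\<lambda>\<theta>. h \<theta> (u \<theta>) :: real)"
  by (rule continuous_on_compose2[OF h, of UNIV "\<lambda>\<theta>. (\<theta>, u \<theta>)", simplified])
     (use u in \<open>auto intro!: continuous_intros\<close>)

lemma tendsto_along_fibre:
  assumes h: "continuous_on (UNIV \<times> {a..b}) (\<lambda>(\<theta>, x). h \<theta> x)"
    and u: "u \<longlonglongrightarrow> x" "\<And>n. u n \<in> {a..b}" "x \<in> {a..b}"
  shows "(\<lambda>n. h \<theta> (u n) :: real) \<longlonglongrightarrow> h \<theta> x"
proof -
  have "(\<lambda>n. (\<theta>, u n)) \<longlonglongrightarrow> (\<theta>, x)" by (intro tendsto_intros u)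
  from continuous_on_tendsto_compose[OF h this] show ?thesis using u by auto
qed

lemma compact_region: "compact (region \<gamma>m \<gamma>p)"
proof -
  have c: "continuous_on UNIV (\<lambda>z::'a \<times> real. \<gamma>m (fst z))"
    "continuous_on UNIV (\<lambda>z::'a \<times> real. \<gamma>p (fst z))"
    using continuous_on_compose2[OF \<gamma>m_cont continuous_on_fst[OF continuous_on_id]]
      continuous_on_compose2[OF \<gamma>p_cont continuous_on_fst[OF continuous_on_id]] by auto
  have "closed ({z::'a \<times> real. \<gamma>m (fst z) \<le> snd z} \<inter> {z. snd z \<le> \<gamma>p (fst z)})"
    by (intro closed_Int closed_Collect_le c continuous_on_snd continuous_on_id)
  moreover have "region \<gamma>m \<gamma>p =
      (UNIV \<times> {a..b}) \<inter> ({z. \<gamma>m (fst z) \<le> snd z} \<inter> {z. snd z \<le> \<gamma>p (fst z)})"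
    by (auto simp: region_def intro: range_ge range_le)
  moreover have "compact (UNIV \<times> {a..b} :: ('a \<times> real) set)"
    by (intro compact_Times compact_base compact_Icc)
  ultimately show ?thesis by (simp only: compact_Int_closed)
qed

lemma region_subset: "region \<gamma>m \<gamma>p \<subseteq> UNIV \<times> {a..b}"
  using in_range by (auto simp: region_def)

lemma dg_cont_region: "continuous_on (region \<gamma>m \<gamma>p) (\<lambda>(\<theta>, x). dg \<theta> x)"
  using dg_cont region_subset by (rule continuous_on_subset)

lemma dg_upper_bound: "\<exists>u. \<forall>\<theta> x. \<gamma>m \<theta> \<le> x \<longrightarrow> x \<le> \<gamma>p \<theta> \<longrightarrow> dg \<theta> x \<le> u"
  using compact_abs_bound[OF compact_region dg_cont_region]
  by (fastforce simp: region_def abs_le_iff)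

lemma ln_dg_bounded: "\<exists>C. \<forall>\<theta> x. \<gamma>m \<theta> \<le> x \<longrightarrow> x \<le> \<gamma>p \<theta> \<longrightarrow> \<bar>ln (dg \<theta> x)\<bar> \<le> C"
proof -
  have "continuous_on (region \<gamma>m \<gamma>p) (\<lambda>z. ln (case z of (\<theta>, x) \<Rightarrow> dg \<theta> x))"
    by (intro continuous_on_ln dg_cont_region ballI)
      (auto simp: region_def dest: dg_pos)
  from compact_abs_bound[OF compact_region this] show ?thesis
    by (fastforce simp: region_def)
qed

text \<open>
  Averaging two invariant curves that stay apart produces a curve which the map pushes strictly
  below itself: at each base point this is strict convexity of the fibre map, and compactness of
  the set of pairs at distance at least \<open>\<delta>\<close> makes the gain uniform.
\<close>

lemma midpoint_supersolution:
  assumes u: "\<And>\<theta>. \<gamma>m \<theta> \<le> u \<theta>" "\<And>\<theta>. u \<theta> \<le> \<gamma>p \<theta>" "\<And>\<theta>. g \<theta> (u \<theta>) = u (\<omega> \<theta>)"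
    and v: "\<And>\<theta>. \<gamma>m \<theta> \<le> v \<theta>" "\<And>\<theta>. v \<theta> \<le> \<gamma>p \<theta>" "\<And>\<theta>. g \<theta> (v \<theta>) = v (\<omega> \<theta>)"
    and gap: "0 < \<delta>" "\<And>\<theta>. \<delta> \<le> \<bar>u \<theta> - v \<theta>\<bar>"
  shows "\<exists>c>0. super c (\<lambda>\<theta>. (u \<theta> + v \<theta>) / 2)"
proof -
  define K where "K = {z::'a \<times> real \<times> real.
    \<gamma>m (fst z) \<le> fst (snd z) \<and> fst (snd z) \<le> \<gamma>p (fst z) \<and>
    \<gamma>m (fst z) \<le> snd (snd z) \<and> snd (snd z) \<le> \<gamma>p (fst z) \<and> \<delta> \<le> \<bar>fst (snd z) - snd (snd z)\<bar>}"
  define H where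
    "H z = (g (fst z) (fst (snd z)) + g (fst z) (snd (snd z))) / 2
      - g (fst z) ((fst (snd z) + snd (snd z)) / 2)" for z :: "'a \<times> real \<times> real"
  have c: "continuous_on UNIV (\<lambda>z::'a \<times> real \<times> real. \<gamma>m (fst z))"
    "continuous_on UNIV (\<lambda>z::'a \<times> real \<times> real. \<gamma>p (fst z))"
    using continuous_on_compose2[OF \<gamma>m_cont continuous_on_fst[OF continuous_on_id]]
      continuous_on_compose2[OF \<gamma>p_cont continuous_on_fst[OF continuous_on_id]] by auto
  have "closed K"
    unfolding K_def
    by (intro closed_Collect_conj closed_Collect_le c continuous_intros)
  moreover have "compact (UNIV \<times> {a..b} \<times> {a..b} :: ('a \<times> real \<times> real) set)"
    by (intro compact_Times compact_base compact_Icc)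
  moreover have sub: "K \<subseteq> UNIV \<times> {a..b} \<times> {a..b}"
    unfolding K_def using in_range by (auto simp del: atLeastAtMost_iff)
  ultimately have K: "compact K"
    by (metis compact_Int_closed inf.absorb2)
  have g': "continuous_on K (\<lambda>z. g (fst z) (p z))"
    if "continuous_on K p" "\<And>z. z \<in> K \<Longrightarrow> p z \<in> {a..b}" for p
    using continuous_on_compose2[OF g_cont, of K "\<lambda>z. (fst z, p z)"] that
    by (simp add: continuous_on_Pair continuous_on_fst continuous_on_id image_subset_iff)
  have H_cont: "continuous_on K H"
    unfolding H_def by (intro continuous_intros g') (use sub in \<open>fastforce+\<close>)
  have H_pos: "0 < H z" if "z \<in> K" for z
  proof -
    obtain \<theta> x y where z: "z = (\<theta>, x, y)" by (cases z)
    have xy: "\<gamma>m \<theta> \<le> x" "x \<le> \<gamma>p \<theta>" "\<gamma>m \<theta> \<le> y" "y \<le> \<gamma>p \<theta>" "x \<noteq> y"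
      using that gap(1) by (auto simp: K_def z)
    define m where "m = (x + y) / 2"
    have m: "\<gamma>m \<theta> \<le> m" "m \<le> \<gamma>p \<theta>" "m \<noteq> x" "m \<noteq> y" using xy by (auto simp: m_def)
    have "g \<theta> m + dg \<theta> m * (x - m) < g \<theta> x" "g \<theta> m + dg \<theta> m * (y - m) < g \<theta> y"
      by (intro tangent m xy)+
    moreover have "dg \<theta> m * (x - m) + dg \<theta> m * (y - m) = 0"
      by (simp add: m_def field_simps)
    ultimately show ?thesis by (simp add: H_def z m_def[symmetric])
  qed
  obtain c where c: "0 < c" "\<forall>z\<in>K. c \<le> H z"
    using compact_positive_bound[OF K H_cont H_pos] by blast
  have "super c (\<lambda>\<theta>. (u \<theta> + v \<theta>) / 2)"
    unfolding supersolution_def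
  proof
    fix \<theta>
    have "(\<theta>, u \<theta>, v \<theta>) \<in> K" using u v gap by (simp add: K_def)
    then have "c \<le> H (\<theta>, u \<theta>, v \<theta>)" using c by blast
    then have "g \<theta> ((u \<theta> + v \<theta>) / 2) + c \<le> (u (\<omega> \<theta>) + v (\<omega> \<theta>)) / 2"
      by (simp only: H_def fst_conv snd_conv u(3) v(3))
    then show "\<gamma>m \<theta> \<le> (u \<theta> + v \<theta>) / 2 \<and> (u \<theta> + v \<theta>) / 2 \<le> \<gamma>p \<theta> \<and>
        g \<theta> ((u \<theta> + v \<theta>) / 2) + c \<le> (u (\<omega> \<theta>) + v (\<omega> \<theta>)) / 2"
      using u(1,2)[of \<theta>] v(1,2)[of \<theta>] by auto
  qed
  then show ?thesis using c by blast
qed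

lemma lower_iterate_in: "lo n \<theta> \<in> {a..b}"
  by (induction n arbitrary: \<theta>) (use \<gamma>m_in g_in in auto)

lemma lower_iterate_cont: "continuous_on UNIV (lo n)"
proof (induction n)
  case (Suc n)
  have "continuous_on UNIV (\<lambda>\<theta>. g \<theta> (lo n \<theta>))"
    using continuous_along_curve[OF g_cont Suc lower_iterate_in] .
  from continuous_on_compose2[OF this \<omega>'_cont] show ?case by simp
qed (simp add: \<gamma>m_cont)

lemma lower_iterate_mono: "lo n \<theta> \<le> lo (Suc n) \<theta>"
proof (induction n arbitrary: \<theta>)
  case 0
  then show ?case using \<gamma>m_up[of "\<omega>' \<theta>"] by simp
next
  case (Suc n)
  show ?case using g_mono[OF lower_iterate_in lower_iterate_in Suc] by simp
qed

lemma supersolution_image_le: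
  assumes "super c \<xi>" "0 \<le> c"
  shows "g \<theta> (\<xi> \<theta>) \<le> \<xi> (\<omega> \<theta>)"
  using assms(1)[unfolded supersolution_def, rule_format, of \<theta>] assms(2) by linarith

text \<open>
  Monotonicity of the fibre maps turns any supersolution into a barrier that the increasing
  iterates of the lower boundary cannot cross.
\<close>

lemma lower_iterate_le_supersolution:
  assumes "super c \<xi>" "0 \<le> c"
  shows "lo n \<theta> \<le> \<xi> \<theta>"
proof (induction n arbitrary: \<theta>)
  case 0
  then show ?case using assms by (simp add: supersolution_def)
next
  case (Suc n)
  have "\<xi> \<eta> \<in> {a..b}" for \<eta> using assms in_range[of \<eta>] unfolding supersolution_def by blast
  then have "g (\<omega>' \<theta>) (lo n (\<omega>' \<theta>)) \<le> g (\<omega>' \<theta>) (\<xi> (\<omega>' \<theta>))"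
    by (intro g_mono lower_iterate_in Suc)
  also have "\<dots> \<le> \<xi> (\<omega> (\<omega>' \<theta>))"
    by (rule supersolution_image_le[OF assms])
  finally show ?case by simp
qed

end

section \<open>The extremal invariant graphs\<close>

text \<open>
  The condition that the forward iterates of the lower boundary stay in the region is equivalent
  to the existence of an invariant graph in it. It has the advantage of being closed under limits
  of parameters.
\<close>

locale convex_forced_bounded = convex_forced +
  assumes lower_iterate_le_\<gamma>p: "lo n \<theta> \<le> \<gamma>p \<theta>"
begin

lemma lower_iterate_incseq: "incseq (\<lambda>n. lo n \<theta>)"
  by (intro incseq_SucI lower_iterate_mono)

lemma \<gamma>m_le_lower_iterate: "\<gamma>m \<theta> \<le> lo n \<theta>"
  using incseqD[OF lower_iterate_incseq, of 0 n \<theta>] by simp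

lemma lower_graph_tendsto: "(\<lambda>n. lo n \<theta>) \<longlonglongrightarrow> \<phi>m \<theta>"
  unfolding lower_graph_def
  by (rule LIMSEQ_incseq_SUP[OF bdd_aboveI2 lower_iterate_incseq]) (rule lower_iterate_le_\<gamma>p)

lemma lower_iterate_le: "lo n \<theta> \<le> \<phi>m \<theta>"
  using incseq_le[OF lower_iterate_incseq lower_graph_tendsto] .

lemma \<gamma>m_le_lower_graph: "\<gamma>m \<theta> \<le> \<phi>m \<theta>"
  using lower_iterate_le[of 0 \<theta>] by simp

lemma lower_graph_le_\<gamma>p: "\<phi>m \<theta> \<le> \<gamma>p \<theta>"
  by (rule LIMSEQ_le_const2[OF lower_graph_tendsto]) (use lower_iterate_le_\<gamma>p in blast)

lemma lower_graph_in: "\<phi>m \<theta> \<in> {a..b}"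
  by (intro in_range[OF \<gamma>m_le_lower_graph lower_graph_le_\<gamma>p])

lemma lower_graph_invariant: "g \<theta> (\<phi>m \<theta>) = \<phi>m (\<omega> \<theta>)"
proof -
  have "(\<lambda>n. g \<theta> (lo n \<theta>)) \<longlonglongrightarrow> g \<theta> (\<phi>m \<theta>)"
    by (intro tendsto_along_fibre[OF g_cont lower_graph_tendsto] lower_iterate_in lower_graph_in)
  moreover have "(\<lambda>n. g \<theta> (lo n \<theta>)) \<longlonglongrightarrow> \<phi>m (\<omega> \<theta>)"
    using LIMSEQ_Suc[OF lower_graph_tendsto[of "\<omega> \<theta>"]] by simp
  ultimately show ?thesis by (rule LIMSEQ_unique)
qed

lemma lower_graph_le_supersolution:
  assumes "super c \<xi>" "0 \<le> c" shows "\<phi>m \<theta> \<le> \<xi> \<theta>"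
  by (rule LIMSEQ_le_const2[OF lower_graph_tendsto])
    (use lower_iterate_le_supersolution[OF assms] in blast)

lemma lower_graph_lsc: "lower_semicont \<phi>m"
  by (rule lower_semicont_limit_from_below[OF lower_iterate_cont lower_iterate_le lower_graph_tendsto])

lemma lower_graph_measurable: "\<phi>m \<in> borel_measurable borel"
  by (rule borel_measurable_LIMSEQ_real[OF lower_graph_tendsto])
    (intro borel_measurable_continuous_onI lower_iterate_cont)

lemma dg_lower_graph_measurable: "(\<lambda>\<theta>. dg \<theta> (\<phi>m \<theta>)) \<in> borel_measurable borel"
proof (rule borel_measurable_LIMSEQ_real)
  show "(\<lambda>n. dg \<theta> (lo n \<theta>)) \<longlonglongrightarrow> dg \<theta> (\<phi>m \<theta>)" for \<theta>
    by (intro tendsto_along_fibre[OF dg_cont lower_graph_tendsto] lower_iterate_in lower_graph_in)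
  show "(\<lambda>\<theta>. dg \<theta> (lo n \<theta>)) \<in> borel_measurable borel" for n
    by (intro borel_measurable_continuous_onI
        continuous_along_curve[OF dg_cont lower_iterate_cont lower_iterate_in])
qed

lemma g_le_cancel: "x \<in> {a..b} \<Longrightarrow> y \<in> {a..b} \<Longrightarrow> g \<theta> x \<le> g \<theta> y \<Longrightarrow> x \<le> y"
  using g_strict_mono[of y x \<theta>] by force

text \<open>
  The lower invariant graph and the upper boundary enclose the curve over \<open>\<omega> \<theta>\<close>, and the images
  of their points over \<open>\<theta>\<close> enclose it as well, so the intermediate value theorem supplies the
  preimage.
\<close>

lemma upper_iterate_step:
  assumes "\<phi>m (\<omega> \<theta>) \<le> up n (\<omega> \<theta>)" "up n (\<omega> \<theta>) \<le> \<gamma>p (\<omega> \<theta>)"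
  shows "\<phi>m \<theta> \<le> up (Suc n) \<theta> \<and> up (Suc n) \<theta> \<le> \<gamma>p \<theta> \<and> g \<theta> (up (Suc n) \<theta>) = up n (\<omega> \<theta>)"
proof -
  have sub: "{\<phi>m \<theta>..\<gamma>p \<theta>} \<subseteq> {a..b}"
    using lower_graph_in \<gamma>p_in by auto
  have "\<exists>x\<ge>\<phi>m \<theta>. x \<le> \<gamma>p \<theta> \<and> g \<theta> x = up n (\<omega> \<theta>)"
  proof (rule IVT')
    show "g \<theta> (\<phi>m \<theta>) \<le> up n (\<omega> \<theta>)" using assms(1) lower_graph_invariant by simp
    show "up n (\<omega> \<theta>) \<le> g \<theta> (\<gamma>p \<theta>)" using assms(2) \<gamma>p_up[of \<theta>] by simp
    show "continuous_on {\<phi>m \<theta>..\<gamma>p \<theta>} (g \<theta>)"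
      using g_fibre_cont sub by (rule continuous_on_subset)
  qed (rule lower_graph_le_\<gamma>p)
  then obtain x where x: "\<phi>m \<theta> \<le> x" "x \<le> \<gamma>p \<theta>" "g \<theta> x = up n (\<omega> \<theta>)" by blast
  then have "x \<in> {a..b}" using sub by auto
  then have "up (Suc n) \<theta> = x"
    using the_inv_into_f_f[OF g_inj, of x \<theta>] x(3) by simp
  then show ?thesis using x by simp
qed

lemma upper_iterate_bounds: "\<phi>m \<theta> \<le> up n \<theta> \<and> up n \<theta> \<le> \<gamma>p \<theta>"
proof (induction n arbitrary: \<theta>)
  case 0
  then show ?case using lower_graph_le_\<gamma>p by simp
next
  case (Suc n)
  show ?case using upper_iterate_step[of \<theta> n] Suc[of "\<omega> \<theta>"] by blast
qed

lemma upper_iterate_image: "g \<theta> (up (Suc n) \<theta>) = up n (\<omega> \<theta>)"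
  using upper_iterate_step[of \<theta> n] upper_iterate_bounds[of "\<omega> \<theta>" n] by blast

lemma upper_iterate_in: "up n \<theta> \<in> {a..b}"
  using upper_iterate_bounds[of \<theta> n] \<gamma>m_le_lower_graph[of \<theta>]
  by (intro in_range) (auto intro: order_trans)

lemma upper_iterate_mono: "up (Suc n) \<theta> \<le> up n \<theta>"
proof (induction n arbitrary: \<theta>)
  case 0
  then show ?case using upper_iterate_bounds[of \<theta> "Suc 0"] by simp
next
  case (Suc n)
  show ?case
    by (rule g_le_cancel[OF upper_iterate_in upper_iterate_in, of \<theta> "Suc (Suc n)" \<theta> "Suc n" \<theta>])
      (unfold upper_iterate_image, rule Suc)
qed

lemma upper_iterate_decseq: "decseq (\<lambda>n. up n \<theta>)"
  by (intro decseq_SucI upper_iterate_mono)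

lemma supersolution_le_upper_iterate:
  assumes "super c \<xi>" "0 \<le> c" shows "\<xi> \<theta> \<le> up n \<theta>"
proof (induction n arbitrary: \<theta>)
  case 0
  then show ?case using assms by (simp add: supersolution_def)
next
  case (Suc n)
  have "g \<theta> (\<xi> \<theta>) \<le> \<xi> (\<omega> \<theta>)"
    by (rule supersolution_image_le[OF assms])
  then have "g \<theta> (\<xi> \<theta>) \<le> g \<theta> (up (Suc n) \<theta>)"
    unfolding upper_iterate_image using Suc[of "\<omega> \<theta>"] by simp
  moreover have "\<xi> \<theta> \<in> {a..b}"
    using assms in_range[of \<theta>] unfolding supersolution_def by blast
  ultimately show ?case using g_le_cancel upper_iterate_in by blast
qed

text \<open>
  The backward iterates involve the inverses of the fibre maps, and their continuity is read off
  from the order: by strict monotonicity, comparing the preimage with a constant \<open>c\<close> amounts to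
  comparing the images under the fibre map, both of which vary continuously.
\<close>

lemma upper_iterate_cont: "continuous_on UNIV (up n)"
proof (induction n)
  case 0
  then show ?case by (simp add: \<gamma>p_cont)
next
  case (Suc n)
  have up\<omega>: "continuous_on UNIV (\<lambda>\<theta>. up n (\<omega> \<theta>))"
    by (rule continuous_on_compose2[OF Suc \<omega>_cont]) simp
  have gc: "continuous_on UNIV (\<lambda>\<theta>. g \<theta> c)" if "c \<in> {a..b}" for c
    by (rule continuous_along_curve[OF g_cont continuous_on_const that])
  have lt: "c < up (Suc n) \<theta> \<longleftrightarrow> g \<theta> c < up n (\<omega> \<theta>)" if "c \<in> {a..b}" for c \<theta>
    using g_strict_mono[OF that upper_iterate_in[of "Suc n" \<theta>], of \<theta>]
      g_mono[OF upper_iterate_in[of "Suc n" \<theta>] that, of \<theta>]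
    unfolding upper_iterate_image by linarith
  have gt: "up (Suc n) \<theta> < c \<longleftrightarrow> up n (\<omega> \<theta>) < g \<theta> c" if "c \<in> {a..b}" for c \<theta>
    using g_strict_mono[OF upper_iterate_in[of "Suc n" \<theta>] that, of \<theta>]
      g_mono[OF that upper_iterate_in[of "Suc n" \<theta>], of \<theta>]
    unfolding upper_iterate_image by linarith
  show ?case
    by (rule continuous_if_levels_open[OF upper_iterate_in], unfold lt gt)
      (intro open_Collect_less gc up\<omega>, assumption)+
qed

lemma upper_graph_tendsto: "(\<lambda>n. up n \<theta>) \<longlonglongrightarrow> \<phi>p \<theta>"
  unfolding upper_graph_def
  by (rule LIMSEQ_decseq_INF[OF bdd_belowI2 upper_iterate_decseq])
    (use upper_iterate_bounds in blast)

lemma upper_graph_le: "\<phi>p \<theta> \<le> up n \<theta>"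
  using decseq_ge[OF upper_iterate_decseq upper_graph_tendsto] .

lemma upper_graph_le_\<gamma>p: "\<phi>p \<theta> \<le> \<gamma>p \<theta>"
  using upper_graph_le[of \<theta> 0] by simp

lemma lower_le_upper: "\<phi>m \<theta> \<le> \<phi>p \<theta>"
  by (rule LIMSEQ_le_const[OF upper_graph_tendsto]) (use upper_iterate_bounds in blast)

lemma \<gamma>m_le_upper_graph: "\<gamma>m \<theta> \<le> \<phi>p \<theta>"
  using \<gamma>m_le_lower_graph lower_le_upper by (rule order_trans)

lemma upper_graph_in: "\<phi>p \<theta> \<in> {a..b}"
  by (intro in_range[OF \<gamma>m_le_upper_graph upper_graph_le_\<gamma>p])

lemma upper_graph_invariant: "g \<theta> (\<phi>p \<theta>) = \<phi>p (\<omega> \<theta>)"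
proof -
  have "(\<lambda>n. g \<theta> (up (Suc n) \<theta>)) \<longlonglongrightarrow> g \<theta> (\<phi>p \<theta>)"
    by (intro tendsto_along_fibre[OF g_cont LIMSEQ_Suc[OF upper_graph_tendsto]]
        upper_iterate_in upper_graph_in)
  moreover have "(\<lambda>n. g \<theta> (up (Suc n) \<theta>)) \<longlonglongrightarrow> \<phi>p (\<omega> \<theta>)"
    unfolding upper_iterate_image by (rule upper_graph_tendsto)
  ultimately show ?thesis by (rule LIMSEQ_unique)
qed

lemma supersolution_le_upper_graph:
  assumes "super c \<xi>" "0 \<le> c" shows "\<xi> \<theta> \<le> \<phi>p \<theta>"
  by (rule LIMSEQ_le_const[OF upper_graph_tendsto])
    (use supersolution_le_upper_iterate[OF assms] in blast)

lemma upper_graph_usc: "upper_semicont \<phi>p"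
  by (rule upper_semicont_limit_from_above[OF upper_iterate_cont upper_graph_le upper_graph_tendsto])

lemma upper_graph_measurable: "\<phi>p \<in> borel_measurable borel"
  by (rule borel_measurable_LIMSEQ_real[OF upper_graph_tendsto])
    (intro borel_measurable_continuous_onI upper_iterate_cont)

lemma dg_upper_graph_measurable: "(\<lambda>\<theta>. dg \<theta> (\<phi>p \<theta>)) \<in> borel_measurable borel"
proof (rule borel_measurable_LIMSEQ_real)
  show "(\<lambda>n. dg \<theta> (up n \<theta>)) \<longlonglongrightarrow> dg \<theta> (\<phi>p \<theta>)" for \<theta>
    by (intro tendsto_along_fibre[OF dg_cont upper_graph_tendsto] upper_iterate_in upper_graph_in)
  show "(\<lambda>\<theta>. dg \<theta> (up n \<theta>)) \<in> borel_measurable borel" for n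
    by (intro borel_measurable_continuous_onI
        continuous_along_curve[OF dg_cont upper_iterate_cont upper_iterate_in])
qed

section \<open>Continuity under a strict supersolution\<close>

lemma strictly_between:
  assumes super: "super c \<xi>" and c: "0 < c"
  shows "\<phi>m \<theta> < \<xi> \<theta>" "\<xi> \<theta> < \<phi>p \<theta>"
proof -
  have \<xi>: "\<gamma>m \<theta> \<le> \<xi> \<theta>" "\<xi> \<theta> \<le> \<gamma>p \<theta>" "g \<theta> (\<xi> \<theta>) + c \<le> \<xi> (\<omega> \<theta>)" for \<theta>
    using super unfolding supersolution_def by blast+
  have \<xi>_in: "\<xi> \<theta> \<in> {a..b}" for \<theta> using \<xi> by (intro in_range)
  have le: "\<phi>m \<theta> \<le> \<xi> \<theta>" "\<xi> \<theta> \<le> \<phi>p \<theta>" for \<theta>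
    using lower_graph_le_supersolution[OF super] supersolution_le_upper_graph[OF super] c by auto
  have "\<phi>m (\<omega> (\<omega>' \<theta>)) \<le> g (\<omega>' \<theta>) (\<xi> (\<omega>' \<theta>))"
    unfolding lower_graph_invariant[symmetric] by (intro g_mono lower_graph_in \<xi>_in le)
  then show "\<phi>m \<theta> < \<xi> \<theta>" using \<xi>(3)[of "\<omega>' \<theta>"] c by simp
  have "\<xi> \<theta> \<noteq> \<phi>p \<theta>"
    using \<xi>(3)[of \<theta>] upper_graph_invariant[of \<theta>] le(2)[of "\<omega> \<theta>"] c by auto
  then show "\<xi> \<theta> < \<phi>p \<theta>" using le(2)[of \<theta>] by simp
qed

text \<open>
  With \<open>D = \<xi> - \<phi>m\<close>, the tangent at \<open>\<phi>m\<close> and the margin \<open>c\<close> show that the slope along \<open>\<phi>m\<close> is at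
  most \<open>\<kappa> D(\<omega> \<theta>) / D \<theta>\<close> with \<open>\<kappa> < 1\<close>: in the metric rescaled by \<open>D\<close>, which is bounded above and
  below, the map contracts along the graph at a uniform rate. Below \<open>\<phi>m\<close> the slopes are smaller
  still, so the continuous iterates of the lower boundary converge to \<open>\<phi>m\<close> uniformly.
\<close>

lemma lower_graph_cont:
  assumes super: "super c \<xi>" and c: "0 < c"
  shows "continuous_on UNIV \<phi>m"
proof -
  define L where "L = b - a"
  define D where "D \<theta> = \<xi> \<theta> - \<phi>m \<theta>" for \<theta>
  have \<xi>: "\<gamma>m \<theta> \<le> \<xi> \<theta>" "\<xi> \<theta> \<le> \<gamma>p \<theta>" "g \<theta> (\<xi> \<theta>) + c \<le> \<xi> (\<omega> \<theta>)" for \<theta>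
    using super unfolding supersolution_def by blast+
  have \<xi>_in: "\<xi> \<theta> \<in> {a..b}" for \<theta> using \<xi> by (intro in_range)
  have le: "\<phi>m \<theta> \<le> \<xi> \<theta>" for \<theta> using lower_graph_le_supersolution[OF super] c by simp
  have DL: "D \<theta> \<le> L" for \<theta> using \<xi>_in[of \<theta>] lower_graph_in[of \<theta>] by (auto simp: D_def L_def)
  have cD: "c \<le> D \<theta>" for \<theta>
  proof -
    have "\<phi>m (\<omega> (\<omega>' \<theta>)) \<le> g (\<omega>' \<theta>) (\<xi> (\<omega>' \<theta>))"
      unfolding lower_graph_invariant[symmetric] by (intro g_mono lower_graph_in \<xi>_in le)
    then show ?thesis using \<xi>(3)[of "\<omega>' \<theta>"] by (simp add: D_def)
  qed
  have L: "0 < L" "c \<le> L" using cD[of undefined] DL[of undefined] c by auto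
  (* On the interval from 0 to L the map D - c lies below (1 - c / L) D. *)
  define \<kappa> where "\<kappa> = 1 - c / L"
  have \<kappa>: "0 \<le> \<kappa>" "\<kappa> < 1" using L c by (auto simp: \<kappa>_def)
  have contract: "dg \<theta> (\<phi>m \<theta>) * D \<theta> \<le> \<kappa> * D (\<omega> \<theta>)" for \<theta>
  proof -
    have "dg \<theta> (\<phi>m \<theta>) * D \<theta> \<le> g \<theta> (\<xi> \<theta>) - g \<theta> (\<phi>m \<theta>)"
      unfolding D_def by (intro tangent_le \<gamma>m_le_lower_graph lower_graph_le_\<gamma>p \<xi>)
    also have "\<dots> \<le> D (\<omega> \<theta>) - c"
      using \<xi>(3)[of \<theta>] by (simp add: D_def lower_graph_invariant)
    also have "\<dots> \<le> \<kappa> * D (\<omega> \<theta>)"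
    proof -
      have "c / L * D (\<omega> \<theta>) \<le> c / L * L"
        using DL L c by (intro mult_left_mono) auto
      then show ?thesis using L by (simp add: \<kappa>_def algebra_simps)
    qed
    finally show ?thesis .
  qed
  define M where "M = L / c"
  have M: "0 < M" using L c by (simp add: M_def)
  have err: "\<phi>m \<theta> - lo n \<theta> \<le> M * \<kappa> ^ n * D \<theta>" for n \<theta>
  proof (induction n arbitrary: \<theta>)
    case 0
    have "\<phi>m \<theta> - \<gamma>m \<theta> \<le> L" using lower_graph_in[of \<theta>] \<gamma>m_in[of \<theta>] by (auto simp: L_def)
    also have "\<dots> \<le> M * D \<theta>"
      using mult_left_mono[OF cD[of \<theta>], of M] M c by (simp add: M_def)
    finally show ?case by simp
  next
    case (Suc n)
    define \<eta> where "\<eta> = \<omega>' \<theta>"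
    have \<theta>: "\<theta> = \<omega> \<eta>" by (simp add: \<eta>_def)
    have "\<phi>m \<theta> - lo (Suc n) \<theta> = g \<eta> (\<phi>m \<eta>) - g \<eta> (lo n \<eta>)"
      by (simp add: \<theta> lower_graph_invariant)
    also have "\<dots> \<le> dg \<eta> (\<phi>m \<eta>) * (\<phi>m \<eta> - lo n \<eta>)"
      using tangent_le[OF \<gamma>m_le_lower_graph lower_graph_le_\<gamma>p \<gamma>m_le_lower_iterate
          lower_iterate_le_\<gamma>p, of \<eta> n] by (simp add: algebra_simps)
    also have "\<dots> \<le> dg \<eta> (\<phi>m \<eta>) * (M * \<kappa> ^ n * D \<eta>)"
      using Suc[of \<eta>] dg_pos[OF \<gamma>m_le_lower_graph lower_graph_le_\<gamma>p, of \<eta>]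
      by (intro mult_left_mono) auto
    also have "\<dots> = M * \<kappa> ^ n * (dg \<eta> (\<phi>m \<eta>) * D \<eta>)" by simp
    also have "\<dots> \<le> M * \<kappa> ^ n * (\<kappa> * D (\<omega> \<eta>))"
      using M \<kappa> by (intro mult_left_mono contract) auto
    finally show ?case by (simp add: \<theta> mult.assoc mult.left_commute)
  qed
  show ?thesis
  proof (rule continuous_geometric_limit[OF lower_iterate_cont _ \<kappa>])
    fix n \<theta>
    have "\<phi>m \<theta> - lo n \<theta> \<le> M * \<kappa> ^ n * D \<theta>" by (rule err)
    also have "\<dots> \<le> M * \<kappa> ^ n * L" using M \<kappa> by (intro mult_left_mono DL) auto
    finally show "\<bar>lo n \<theta> - \<phi>m \<theta>\<bar> \<le> M * L * \<kappa> ^ n"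
      using lower_iterate_le[of n \<theta>] by (simp add: mult_ac)
  qed
qed

text \<open>
  The mirror image: along \<open>\<phi>p\<close> the map expands uniformly in the metric rescaled by
  \<open>D = \<phi>p - \<xi>\<close>, and above \<open>\<phi>p\<close> the slopes are larger still, so the preimages of the upper boundary
  converge uniformly. The lower bound on \<open>D\<close> now comes from the expansion itself, \<open>c \<le> dg D \<le> u D\<close>.
\<close>

lemma upper_graph_cont:
  assumes super: "super c \<xi>" and c: "0 < c"
  shows "continuous_on UNIV \<phi>p"
proof -
  define L where "L = b - a"
  define D where "D \<theta> = \<phi>p \<theta> - \<xi> \<theta>" for \<theta>
  have \<xi>: "\<gamma>m \<theta> \<le> \<xi> \<theta>" "\<xi> \<theta> \<le> \<gamma>p \<theta>" "g \<theta> (\<xi> \<theta>) + c \<le> \<xi> (\<omega> \<theta>)" for \<theta>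
    using super unfolding supersolution_def by blast+
  have \<xi>_in: "\<xi> \<theta> \<in> {a..b}" for \<theta> using \<xi> by (intro in_range)
  have le: "\<xi> \<theta> \<le> \<phi>p \<theta>" for \<theta> using supersolution_le_upper_graph[OF super] c by simp
  have DL: "D \<theta> \<le> L" for \<theta> using \<xi>_in[of \<theta>] upper_graph_in[of \<theta>] by (auto simp: D_def L_def)
  have D0: "0 \<le> D \<theta>" for \<theta> using le by (simp add: D_def)
  obtain u where bound: "\<And>\<theta> x. \<gamma>m \<theta> \<le> x \<Longrightarrow> x \<le> \<gamma>p \<theta> \<Longrightarrow> dg \<theta> x \<le> u"
    using dg_upper_bound by blast
  have pos: "0 < dg \<theta> (\<phi>p \<theta>)" and dgu: "dg \<theta> (\<phi>p \<theta>) \<le> u" for \<theta>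
    using dg_pos bound \<gamma>m_le_upper_graph upper_graph_le_\<gamma>p by auto
  have expand: "D (\<omega> \<theta>) + c \<le> dg \<theta> (\<phi>p \<theta>) * D \<theta>" for \<theta>
  proof -
    have "D (\<omega> \<theta>) + c \<le> g \<theta> (\<phi>p \<theta>) - g \<theta> (\<xi> \<theta>)"
      using \<xi>(3)[of \<theta>] by (simp add: D_def upper_graph_invariant)
    also have "\<dots> \<le> dg \<theta> (\<phi>p \<theta>) * D \<theta>"
      using tangent_le[OF \<gamma>m_le_upper_graph upper_graph_le_\<gamma>p \<xi>(1,2), of \<theta>]
      by (simp add: D_def algebra_simps)
    finally show ?thesis .
  qed
  have u: "0 < u" using pos dgu by (rule less_le_trans)
  have cD: "c / u \<le> D \<theta>" for \<theta>
  proof -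
    have "c \<le> dg \<theta> (\<phi>p \<theta>) * D \<theta>" using expand[of \<theta>] D0[of "\<omega> \<theta>"] by linarith
    also have "\<dots> \<le> u * D \<theta>" by (intro mult_right_mono dgu D0)
    finally show ?thesis using u by (simp add: divide_le_eq mult.commute)
  qed
  have L: "0 < L"
    using cD[of undefined] DL[of undefined] c u by (meson divide_pos_pos less_le_trans)
  (* For D at most L, the quotient D / (D + c) is at most L / (L + c). *)
  define \<kappa> where "\<kappa> = L / (L + c)"
  have \<kappa>: "0 \<le> \<kappa>" "\<kappa> < 1" using L c by (auto simp: \<kappa>_def)
  have contract: "D (\<omega> \<theta>) \<le> dg \<theta> (\<phi>p \<theta>) * (\<kappa> * D \<theta>)" for \<theta>
  proof -
    have "D (\<omega> \<theta>) * (L + c) \<le> L * (D (\<omega> \<theta>) + c)"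
      using DL[of "\<omega> \<theta>"] c by (simp add: algebra_simps)
    also have "\<dots> \<le> L * (dg \<theta> (\<phi>p \<theta>) * D \<theta>)"
      using L by (intro mult_left_mono expand) auto
    finally have "D (\<omega> \<theta>) \<le> (L * (dg \<theta> (\<phi>p \<theta>) * D \<theta>)) / (L + c)"
      using L c by (simp add: pos_le_divide_eq)
    then show ?thesis by (simp add: \<kappa>_def mult_ac)
  qed
  define M where "M = L * u / c"
  have M: "0 < M" using L c u by (simp add: M_def)
  have err: "up n \<theta> - \<phi>p \<theta> \<le> M * \<kappa> ^ n * D \<theta>" for n \<theta>
  proof (induction n arbitrary: \<theta>)
    case 0
    have "\<gamma>p \<theta> - \<phi>p \<theta> \<le> L" using upper_graph_in[of \<theta>] \<gamma>p_in[of \<theta>] by (auto simp: L_def)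
    also have "\<dots> \<le> M * D \<theta>"
      using mult_left_mono[OF cD[of \<theta>], of M] M c u by (simp add: M_def)
    finally show ?case by simp
  next
    case (Suc n)
    have b: "\<gamma>m \<theta> \<le> up (Suc n) \<theta>" "up (Suc n) \<theta> \<le> \<gamma>p \<theta>"
      using upper_iterate_bounds[of \<theta> "Suc n"] \<gamma>m_le_lower_graph[of \<theta>] by auto
    have "dg \<theta> (\<phi>p \<theta>) * (up (Suc n) \<theta> - \<phi>p \<theta>) \<le> g \<theta> (up (Suc n) \<theta>) - g \<theta> (\<phi>p \<theta>)"
      by (intro tangent_le \<gamma>m_le_upper_graph upper_graph_le_\<gamma>p b)
    also have "\<dots> = up n (\<omega> \<theta>) - \<phi>p (\<omega> \<theta>)"
      unfolding upper_iterate_image upper_graph_invariant ..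
    also have "\<dots> \<le> M * \<kappa> ^ n * D (\<omega> \<theta>)" by (rule Suc)
    also have "\<dots> \<le> M * \<kappa> ^ n * (dg \<theta> (\<phi>p \<theta>) * (\<kappa> * D \<theta>))"
      using M \<kappa> by (intro mult_left_mono contract) auto
    also have "\<dots> = dg \<theta> (\<phi>p \<theta>) * (M * \<kappa> ^ Suc n * D \<theta>)" by simp
    finally show ?case using pos by (simp only: mult_le_cancel_left_pos)
  qed
  show ?thesis
  proof (rule continuous_geometric_limit[OF upper_iterate_cont _ \<kappa>])
    fix n \<theta>
    have "up n \<theta> - \<phi>p \<theta> \<le> M * \<kappa> ^ n * D \<theta>" by (rule err)
    also have "\<dots> \<le> M * \<kappa> ^ n * L" using M \<kappa> by (intro mult_left_mono DL) auto
    finally show "\<bar>up n \<theta> - \<phi>p \<theta>\<bar> \<le> M * L * \<kappa> ^ n"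
      using upper_graph_le[of \<theta> n] by (simp add: mult_ac)
  qed
qed

section \<open>Signs of the Lyapunov exponents\<close>

lemma ln_dg_integrable:
  assumes inv: "invariant_measure \<omega> \<mu>"
    and u: "(\<lambda>\<theta>. dg \<theta> (u \<theta>)) \<in> borel_measurable borel" "\<And>\<theta>. \<gamma>m \<theta> \<le> u \<theta>" "\<And>\<theta>. u \<theta> \<le> \<gamma>p \<theta>"
  shows "integrable \<mu> (\<lambda>\<theta>. ln (dg \<theta> (u \<theta>)))"
proof -
  interpret prob_space \<mu> using inv by (simp add: invariant_measure_def)
  have sets: "sets \<mu> = sets borel" using inv by (simp add: invariant_measure_def)
  obtain C where C: "\<And>\<theta> x. \<gamma>m \<theta> \<le> x \<Longrightarrow> x \<le> \<gamma>p \<theta> \<Longrightarrow> \<bar>ln (dg \<theta> x)\<bar> \<le> C"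
    using ln_dg_bounded by blast
  have "(\<lambda>\<theta>. ln (dg \<theta> (u \<theta>))) \<in> borel_measurable borel" using u(1) by measurable
  then have "(\<lambda>\<theta>. ln (dg \<theta> (u \<theta>))) \<in> borel_measurable \<mu>"
    using measurable_cong_sets[OF sets refl] by blast
  then show ?thesis
    by (intro integrable_const_bound[where B = C]) (simp_all add: C u)
qed

text \<open>
  With \<open>\<Delta> = \<phi>p - \<phi>m\<close>, the quotient \<open>\<Delta>(\<omega> \<theta>) / \<Delta> \<theta>\<close> is the slope of the chord of the
  fibre map between the two graphs, and strict convexity places it strictly between the two tangent slopes. Its logarithm
  is the coboundary of \<open>ln \<Delta>\<close>, whose integral vanishes. Since \<open>\<Delta>\<close> may come arbitrarily close to
  zero, \<open>ln \<Delta>\<close> need not be integrable; its coboundary is nevertheless bounded,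
  by the logarithms of the tangent slopes.
\<close>

lemma lyapunov_signs:
  assumes inv: "invariant_measure \<omega> \<mu>" and less: "AE \<theta> in \<mu>. \<phi>m \<theta> < \<phi>p \<theta>"
  shows "(\<integral>\<theta>. ln (dg \<theta> (\<phi>m \<theta>)) \<partial>\<mu>) < 0" and "0 < (\<integral>\<theta>. ln (dg \<theta> (\<phi>p \<theta>)) \<partial>\<mu>)"
proof -
  interpret prob_space \<mu> using inv by (simp add: invariant_measure_def)
  define h where "h \<theta> = ln (\<phi>p \<theta> - \<phi>m \<theta>)" for \<theta>
  have hm: "h \<in> borel_measurable borel"
    unfolding h_def using lower_graph_measurable upper_graph_measurable by measurable
  have sandwich: "ln (dg \<theta> (\<phi>m \<theta>)) < h (\<omega> \<theta>) - h \<theta> \<and> h (\<omega> \<theta>) - h \<theta> < ln (dg \<theta> (\<phi>p \<theta>))"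
    if lt: "\<phi>m \<theta> < \<phi>p \<theta>" for \<theta>
  proof -
    define \<Delta> where "\<Delta> = \<phi>p \<theta> - \<phi>m \<theta>"
    define \<Delta>' where "\<Delta>' = \<phi>p (\<omega> \<theta>) - \<phi>m (\<omega> \<theta>)"
    have \<Delta>: "0 < \<Delta>" using lt by (simp add: \<Delta>_def)
    have \<Delta>': "0 < \<Delta>'"
      using g_strict_mono[OF lower_graph_in upper_graph_in lt, of \<theta>]
      by (simp add: \<Delta>'_def lower_graph_invariant upper_graph_invariant)
    have pm: "0 < dg \<theta> (\<phi>m \<theta>)" and pp: "0 < dg \<theta> (\<phi>p \<theta>)"
      by (intro dg_pos \<gamma>m_le_lower_graph lower_graph_le_\<gamma>p \<gamma>m_le_upper_graph upper_graph_le_\<gamma>p)+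
    have "dg \<theta> (\<phi>m \<theta>) * \<Delta> < \<Delta>'"
      using tangent[OF \<gamma>m_le_lower_graph lower_graph_le_\<gamma>p \<gamma>m_le_upper_graph upper_graph_le_\<gamma>p, of \<theta>] lt
      unfolding lower_graph_invariant upper_graph_invariant \<Delta>_def \<Delta>'_def by simp
    moreover have "\<Delta>' < dg \<theta> (\<phi>p \<theta>) * \<Delta>"
      using tangent[OF \<gamma>m_le_upper_graph upper_graph_le_\<gamma>p \<gamma>m_le_lower_graph lower_graph_le_\<gamma>p, of \<theta>] lt
      unfolding lower_graph_invariant upper_graph_invariant \<Delta>_def \<Delta>'_def by (simp add: algebra_simps)
    ultimately have "ln (dg \<theta> (\<phi>m \<theta>) * \<Delta>) < ln \<Delta>'" "ln \<Delta>' < ln (dg \<theta> (\<phi>p \<theta>) * \<Delta>)"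
      using \<Delta> \<Delta>' pm pp by simp_all
    then show ?thesis
      using \<Delta> pm pp by (simp add: h_def \<Delta>_def[symmetric] \<Delta>'_def[symmetric] ln_mult)
  qed
  obtain C where C: "\<And>\<theta> x. \<gamma>m \<theta> \<le> x \<Longrightarrow> x \<le> \<gamma>p \<theta> \<Longrightarrow> \<bar>ln (dg \<theta> x)\<bar> \<le> C"
    using ln_dg_bounded by blast
  have "AE \<theta> in \<mu>. \<bar>h (\<omega> \<theta>) - h \<theta>\<bar> \<le> C"
    using less
  proof eventually_elim
    case (elim \<theta>)
    show ?case
      using sandwich[OF elim] C[OF \<gamma>m_le_lower_graph lower_graph_le_\<gamma>p, of \<theta>]
        C[OF \<gamma>m_le_upper_graph upper_graph_le_\<gamma>p, of \<theta>] by linarith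
  qed
  note cob = integral_coboundary_eq_0[OF inv \<omega>_cont hm this]
  have im: "integrable \<mu> (\<lambda>\<theta>. ln (dg \<theta> (\<phi>m \<theta>)))"
    by (intro ln_dg_integrable[OF inv dg_lower_graph_measurable] \<gamma>m_le_lower_graph lower_graph_le_\<gamma>p)
  have ip: "integrable \<mu> (\<lambda>\<theta>. ln (dg \<theta> (\<phi>p \<theta>)))"
    by (intro ln_dg_integrable[OF inv dg_upper_graph_measurable] \<gamma>m_le_upper_graph upper_graph_le_\<gamma>p)
  have "(\<integral>\<theta>. ln (dg \<theta> (\<phi>m \<theta>)) \<partial>\<mu>) < (\<integral>\<theta>. h (\<omega> \<theta>) - h \<theta> \<partial>\<mu>)"
    by (rule integral_less_AE_space[OF im cob(1)])
      (use less sandwich in \<open>auto elim: eventually_mono simp: emeasure_space_1\<close>)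
  then show "(\<integral>\<theta>. ln (dg \<theta> (\<phi>m \<theta>)) \<partial>\<mu>) < 0" by (simp only: cob(2))
  have "(\<integral>\<theta>. h (\<omega> \<theta>) - h \<theta> \<partial>\<mu>) < (\<integral>\<theta>. ln (dg \<theta> (\<phi>p \<theta>)) \<partial>\<mu>)"
    by (rule integral_less_AE_space[OF cob(1) ip])
      (use less sandwich in \<open>auto elim: eventually_mono simp: emeasure_space_1\<close>)
  then show "0 < (\<integral>\<theta>. ln (dg \<theta> (\<phi>p \<theta>)) \<partial>\<mu>)" by (simp only: cob(2))
qed

end

section \<open>The critical parameter of an increasing family\<close>

locale forced_family =
  fixes \<omega> \<omega>' :: "'a::metric_space \<Rightarrow> 'a" and a b :: real
    and g dg :: "real \<Rightarrow> 'a \<Rightarrow> real \<Rightarrow> real" and \<gamma>m \<gamma>p :: "'a \<Rightarrow> real"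
  assumes map: "\<beta> \<in> {0..1} \<Longrightarrow> convex_forced \<omega> \<omega>' a b (g \<beta>) (dg \<beta>) \<gamma>m \<gamma>p"
    and g_joint: "continuous_on ({0..1} \<times> UNIV \<times> {a..b}) (\<lambda>(\<beta>, \<theta>, x). g \<beta> \<theta> x)"
    and dg_joint: "continuous_on ({0..1} \<times> UNIV \<times> {a..b}) (\<lambda>(\<beta>, \<theta>, x). dg \<beta> \<theta> x)"
    and increasing: "\<beta> \<in> {0..1} \<Longrightarrow> \<beta>' \<in> {0..1} \<Longrightarrow> \<beta> < \<beta>' \<Longrightarrow> \<gamma>m \<theta> \<le> x \<Longrightarrow> x \<le> \<gamma>p \<theta> \<Longrightarrow>
      g \<beta> \<theta> x < g \<beta>' \<theta> x"
begin

definition feasible :: "real set" where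
  "feasible = {\<beta> \<in> {0..1}. \<forall>n \<theta>. lower_iterate \<omega>' (g \<beta>) \<gamma>m n \<theta> \<le> \<gamma>p \<theta>}"

abbreviation "\<Phi>m \<beta> \<equiv> lower_graph \<omega>' (g \<beta>) \<gamma>m"
abbreviation "\<Phi>p \<beta> \<equiv> upper_graph \<omega> {a..b} (g \<beta>) \<gamma>p"
abbreviation "Super \<beta> \<equiv> supersolution \<omega> (g \<beta>) \<gamma>m \<gamma>p"

lemma feasible_unit: "\<beta> \<in> feasible \<Longrightarrow> \<beta> \<in> {0..1}"
  by (simp add: feasible_def)

lemma bounded: "\<beta> \<in> feasible \<Longrightarrow> convex_forced_bounded \<omega> \<omega>' a b (g \<beta>) (dg \<beta>) \<gamma>m \<gamma>p"
  using map[of \<beta>] by (simp add: feasible_def convex_forced_bounded_def convex_forced_bounded_axioms_def)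

lemma feasible_if_supersolution:
  assumes "\<beta> \<in> {0..1}" "Super \<beta> c \<xi>" "0 \<le> c"
  shows "\<beta> \<in> feasible"
proof -
  interpret convex_forced \<omega> \<omega>' a b "g \<beta>" "dg \<beta>" \<gamma>m \<gamma>p by (rule map[OF assms(1)])
  have "\<xi> \<theta> \<le> \<gamma>p \<theta>" for \<theta> using assms(2) by (simp add: supersolution_def)
  then show ?thesis
    using lower_iterate_le_supersolution[OF assms(2,3)] assms(1)
    by (auto simp: feasible_def intro: order_trans)
qed

lemma tendsto_joint:
  assumes h: "continuous_on ({0..1} \<times> UNIV \<times> {a..b}) (\<lambda>(\<beta>, \<theta>, x). h \<beta> \<theta> x)"
    and "(s \<longlongrightarrow> \<beta>) F" "(u \<longlongrightarrow> x) F"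
    and "\<forall>\<^sub>F k in F. s k \<in> {0..1} \<and> u k \<in> {a..b}" "\<beta> \<in> {0..1}" "x \<in> {a..b}"
  shows "((\<lambda>k. h (s k) \<theta> (u k) :: real) \<longlongrightarrow> h \<beta> \<theta> x) F"
proof -
  have "((\<lambda>k. (s k, \<theta>, u k)) \<longlongrightarrow> (\<beta>, \<theta>, x)) F" by (intro tendsto_intros assms)
  from continuous_on_tendsto_compose[OF h this] show ?thesis
    using assms by (auto elim: eventually_mono)
qed

text \<open>
  Each of the inequalities that define feasibility involves finitely many iterations, hence is a
  closed condition on the parameter.
\<close>

lemma lower_iterate_param_cont:
  "continuous_on {0..1} (\<lambda>\<beta>. lower_iterate \<omega>' (g \<beta>) \<gamma>m n \<theta>)"
proof (induction n arbitrary: \<theta>)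
  case 0
  then show ?case by simp
next
  case (Suc n)
  have "lower_iterate \<omega>' (g \<beta>) \<gamma>m n \<eta> \<in> {a..b}" if "\<beta> \<in> {0..1}" for \<beta> \<eta>
    using convex_forced.lower_iterate_in[OF map[OF that]] .
  then have "continuous_on {0..1} (\<lambda>\<beta>. g \<beta> (\<omega>' \<theta>) (lower_iterate \<omega>' (g \<beta>) \<gamma>m n (\<omega>' \<theta>)))"
    using continuous_on_compose2[OF g_joint,
        of "{0..1}" "\<lambda>\<beta>. (\<beta>, \<omega>' \<theta>, lower_iterate \<omega>' (g \<beta>) \<gamma>m n (\<omega>' \<theta>))"] Suc
    by (simp add: continuous_on_Pair continuous_on_id continuous_on_const image_subset_iff)
  then show ?case by simp
qed

lemma feasible_closed: "closed feasible"
proof -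
  have "feasible = {0..1} \<inter>
      (\<Inter>n. \<Inter>\<theta>. {\<beta> \<in> {0..1}. lower_iterate \<omega>' (g \<beta>) \<gamma>m n \<theta> \<le> \<gamma>p \<theta>})"
    by (auto simp: feasible_def)
  also have "closed \<dots>"
    by (intro closed_Int closed_atLeastAtMost closed_INT ballI
        continuous_on_closed_Collect_le lower_iterate_param_cont continuous_on_const)
  finally show ?thesis .
qed

text \<open>
  Lowering the parameter lowers the fibre maps, by a uniform amount on the compact region. Hence a
  supersolution for one parameter is a strict one for every smaller parameter.
\<close>

lemma strict_supersolution_of_smaller:
  assumes \<beta>: "\<beta> \<in> {0..1}" "\<beta>' \<in> {0..1}" "\<beta> < \<beta>'" and super: "Super \<beta>' 0 \<xi>"
  shows "\<exists>c>0. Super \<beta> c \<xi>"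
proof -
  interpret P: convex_forced \<omega> \<omega>' a b "g \<beta>" "dg \<beta>" \<gamma>m \<gamma>p by (rule map[OF \<beta>(1)])
  interpret Q: convex_forced \<omega> \<omega>' a b "g \<beta>'" "dg \<beta>'" \<gamma>m \<gamma>p by (rule map[OF \<beta>(2)])
  have "continuous_on (region \<gamma>m \<gamma>p) (\<lambda>z. (case z of (\<theta>, x) \<Rightarrow> g \<beta>' \<theta> x) - (case z of (\<theta>, x) \<Rightarrow> g \<beta> \<theta> x))"
    by (intro continuous_on_diff continuous_on_subset[OF P.g_cont P.region_subset]
        continuous_on_subset[OF Q.g_cont P.region_subset])
  from compact_positive_bound[OF P.compact_region this]
  obtain c where c: "0 < c" "\<forall>z\<in>region \<gamma>m \<gamma>p. c \<le> (case z of (\<theta>, x) \<Rightarrow> g \<beta>' \<theta> x) - (case z of (\<theta>, x) \<Rightarrow> g \<beta> \<theta> x)"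
    using increasing[OF \<beta>] by (auto simp: region_def)
  have "Super \<beta> c \<xi>"
    unfolding supersolution_def
  proof
    fix \<theta>
    have \<xi>: "\<gamma>m \<theta> \<le> \<xi> \<theta>" "\<xi> \<theta> \<le> \<gamma>p \<theta>" "g \<beta>' \<theta> (\<xi> \<theta>) \<le> \<xi> (\<omega> \<theta>)"
      using super by (auto simp: supersolution_def)
    then have "(\<theta>, \<xi> \<theta>) \<in> region \<gamma>m \<gamma>p" by (simp add: region_def)
    then have "c \<le> g \<beta>' \<theta> (\<xi> \<theta>) - g \<beta> \<theta> (\<xi> \<theta>)" using c(2) by fastforce
    then show "\<gamma>m \<theta> \<le> \<xi> \<theta> \<and> \<xi> \<theta> \<le> \<gamma>p \<theta> \<and> g \<beta> \<theta> (\<xi> \<theta>) + c \<le> \<xi> (\<omega> \<theta>)"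
      using \<xi> by simp
  qed
  then show ?thesis using c(1) by blast
qed

lemma lower_graph_supersolution:
  assumes "\<beta> \<in> feasible" shows "Super \<beta> 0 (\<Phi>m \<beta>)"
proof -
  interpret convex_forced_bounded \<omega> \<omega>' a b "g \<beta>" "dg \<beta>" \<gamma>m \<gamma>p by (rule bounded[OF assms])
  show ?thesis
    by (simp add: supersolution_def \<gamma>m_le_lower_graph lower_graph_le_\<gamma>p lower_graph_invariant)
qed

lemma upper_graph_supersolution:
  assumes "\<beta> \<in> feasible" shows "Super \<beta> 0 (\<Phi>p \<beta>)"
proof -
  interpret convex_forced_bounded \<omega> \<omega>' a b "g \<beta>" "dg \<beta>" \<gamma>m \<gamma>p by (rule bounded[OF assms])
  show ?thesis
    by (simp add: supersolution_def \<gamma>m_le_upper_graph upper_graph_le_\<gamma>p upper_graph_invariant)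
qed

lemma strict_supersolution_below_feasible:
  assumes "\<beta> \<in> {0..1}" "\<beta>' \<in> feasible" "\<beta> < \<beta>'"
  shows "\<beta> \<in> feasible" "\<exists>c>0. Super \<beta> c (\<Phi>m \<beta>')" "\<exists>c>0. Super \<beta> c (\<Phi>p \<beta>')"
proof -
  show 1: "\<exists>c>0. Super \<beta> c (\<Phi>m \<beta>')"
    by (rule strict_supersolution_of_smaller[OF assms(1) feasible_unit[OF assms(2)] assms(3)
          lower_graph_supersolution[OF assms(2)]])
  then show "\<beta> \<in> feasible" using feasible_if_supersolution[OF assms(1)] by (meson less_imp_le)
  show "\<exists>c>0. Super \<beta> c (\<Phi>p \<beta>')"
    by (rule strict_supersolution_of_smaller[OF assms(1) feasible_unit[OF assms(2)] assms(3)
          upper_graph_supersolution[OF assms(2)]])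
qed

text \<open>
  Conversely, the margin of a strict supersolution leaves room for a slightly larger parameter.
\<close>

lemma feasible_beyond_strict_supersolution:
  assumes \<beta>: "\<beta> \<in> {0..<1}" and super: "Super \<beta> c \<xi>" and c: "0 < c"
  shows "\<exists>\<beta>'\<in>feasible. \<beta> < \<beta>'"
proof -
  interpret convex_forced \<omega> \<omega>' a b "g \<beta>" "dg \<beta>" \<gamma>m \<gamma>p by (rule map) (use \<beta> in auto)
  have "compact ({0..1} \<times> UNIV \<times> {a..b} :: (real \<times> 'a \<times> real) set)"
    by (intro compact_Times compact_base compact_Icc)
  from compact_uniformly_continuous[OF g_joint this]
  obtain \<delta> where \<delta>: "0 < \<delta>"
    "\<forall>z\<in>{0..1} \<times> UNIV \<times> {a..b}. \<forall>z'\<in>{0..1} \<times> UNIV \<times> {a..b}. dist z' z < \<delta> \<longrightarrow>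
      dist (case z' of (\<beta>, \<theta>, x) \<Rightarrow> g \<beta> \<theta> x) (case z of (\<beta>, \<theta>, x) \<Rightarrow> g \<beta> \<theta> x) < c"
    using c unfolding uniformly_continuous_on_def by blast
  define \<beta>' where "\<beta>' = min 1 (\<beta> + \<delta> / 2)"
  have \<beta>': "\<beta>' \<in> {0..1}" "\<beta> < \<beta>'" "\<bar>\<beta>' - \<beta>\<bar> < \<delta>"
    using \<beta> \<delta>(1) by (auto simp: \<beta>'_def min_def)
  have "Super \<beta>' 0 \<xi>"
    unfolding supersolution_def
  proof
    fix \<theta>
    have \<xi>: "\<gamma>m \<theta> \<le> \<xi> \<theta>" "\<xi> \<theta> \<le> \<gamma>p \<theta>" "g \<beta> \<theta> (\<xi> \<theta>) + c \<le> \<xi> (\<omega> \<theta>)"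
      using super by (auto simp: supersolution_def)
    have z: "(\<beta>, \<theta>, \<xi> \<theta>) \<in> {0..1} \<times> UNIV \<times> {a..b}" "(\<beta>', \<theta>, \<xi> \<theta>) \<in> {0..1} \<times> UNIV \<times> {a..b}"
      using \<beta> \<beta>'(1) in_range[OF \<xi>(1,2)] by auto
    have "dist (\<beta>', \<theta>, \<xi> \<theta>) (\<beta>, \<theta>, \<xi> \<theta>) < \<delta>"
      using \<beta>'(3) by (simp add: dist_Pair_Pair dist_real_def)
    then have "dist (g \<beta>' \<theta> (\<xi> \<theta>)) (g \<beta> \<theta> (\<xi> \<theta>)) < c"
      using bspec[OF bspec[OF \<delta>(2) z(1)] z(2)] by simp
    then show "\<gamma>m \<theta> \<le> \<xi> \<theta> \<and> \<xi> \<theta> \<le> \<gamma>p \<theta> \<and> g \<beta>' \<theta> (\<xi> \<theta>) + 0 \<le> \<xi> (\<omega> \<theta>)"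
      using \<xi> by (simp add: dist_real_def)
  qed
  then show ?thesis using feasible_if_supersolution[OF \<beta>'(1)] \<beta>'(2) by blast
qed

lemma subcritical:
  assumes "\<beta> \<in> {0..1}" "\<beta>' \<in> feasible" "\<beta> < \<beta>'"
  shows "continuous_on UNIV (\<Phi>m \<beta>)" "continuous_on UNIV (\<Phi>p \<beta>)"
    and "\<Phi>m \<beta> \<theta> < \<Phi>m \<beta>' \<theta>" "\<Phi>p \<beta>' \<theta> < \<Phi>p \<beta> \<theta>" "\<Phi>m \<beta> \<theta> < \<Phi>p \<beta> \<theta>"
proof -
  note below = strict_supersolution_below_feasible[OF assms]
  interpret convex_forced_bounded \<omega> \<omega>' a b "g \<beta>" "dg \<beta>" \<gamma>m \<gamma>p by (rule bounded[OF below(1)])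
  obtain c where c: "0 < c" "Super \<beta> c (\<Phi>m \<beta>')" using below(2) by blast
  obtain d where d: "0 < d" "Super \<beta> d (\<Phi>p \<beta>')" using below(3) by blast
  show "continuous_on UNIV (\<Phi>m \<beta>)" "continuous_on UNIV (\<Phi>p \<beta>)"
    using lower_graph_cont[OF c(2,1)] upper_graph_cont[OF c(2,1)] .
  show "\<Phi>m \<beta> \<theta> < \<Phi>m \<beta>' \<theta>" "\<Phi>p \<beta>' \<theta> < \<Phi>p \<beta> \<theta>"
    using strictly_between[OF c(2,1)] strictly_between[OF d(2,1)] by auto
  show "\<Phi>m \<beta> \<theta> < \<Phi>p \<beta> \<theta>"
    using strictly_between[OF c(2,1), of \<theta>] by simp
qed

definition critical :: real where
  "critical = Sup feasible"

lemma le_critical: "\<beta> \<in> feasible \<Longrightarrow> \<beta> \<le> critical"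
  unfolding critical_def by (rule cSup_upper) (auto simp: feasible_def bdd_above_def)

lemma critical_feasible:
  assumes "feasible \<noteq> {}" shows "critical \<in> feasible"
  unfolding critical_def
  by (rule closed_contains_Sup[OF assms _ feasible_closed]) (auto simp: feasible_def bdd_above_def)

text \<open>
  A positive gap between the extremal graphs would make their average a strict supersolution, and
  the parameter could be increased.
\<close>

lemma critical_gap_zero:
  assumes crit: "critical \<in> feasible" "critical < 1"
  shows "(INF \<theta>. \<Phi>p critical \<theta> - \<Phi>m critical \<theta>) = 0"
proof -
  interpret convex_forced_bounded \<omega> \<omega>' a b "g critical" "dg critical" \<gamma>m \<gamma>p
    by (rule bounded[OF crit(1)])
  define \<delta> where "\<delta> = (INF \<theta>. \<Phi>p critical \<theta> - \<Phi>m critical \<theta>)"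
  have "0 \<le> \<delta>" unfolding \<delta>_def
    by (rule cINF_greatest) (simp_all add: lower_le_upper)
  moreover have "\<not> 0 < \<delta>"
  proof
    assume \<delta>: "0 < \<delta>"
    have "bdd_below (range (\<lambda>\<theta>. \<Phi>p critical \<theta> - \<Phi>m critical \<theta>))"
      by (rule bdd_belowI2[where m = 0]) (simp add: lower_le_upper)
    then have "\<delta> \<le> \<Phi>p critical \<theta> - \<Phi>m critical \<theta>" for \<theta>
      unfolding \<delta>_def by (rule cINF_lower) simp
    then have "\<delta> \<le> \<bar>\<Phi>p critical \<theta> - \<Phi>m critical \<theta>\<bar>" for \<theta>
      using abs_ge_self order_trans by blast
    from midpoint_supersolution[OF \<gamma>m_le_upper_graph upper_graph_le_\<gamma>p upper_graph_invariant
        \<gamma>m_le_lower_graph lower_graph_le_\<gamma>p lower_graph_invariant \<delta> this]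
    obtain c where c: "0 < c" "Super critical c (\<lambda>\<theta>. (\<Phi>p critical \<theta> + \<Phi>m critical \<theta>) / 2)"
      by blast
    have "critical \<in> {0..<1}" using feasible_unit[OF crit(1)] crit(2) by simp
    from feasible_beyond_strict_supersolution[OF this c(2,1)]
    show False using le_critical by fastforce
  qed
  ultimately show ?thesis by (simp add: \<delta>_def)
qed

lemma ln_dg_uniform_bound:
  "\<exists>C. \<forall>\<beta>\<in>{0..1}. \<forall>\<theta> x. \<gamma>m \<theta> \<le> x \<longrightarrow> x \<le> \<gamma>p \<theta> \<longrightarrow> \<bar>ln (dg \<beta> \<theta> x)\<bar> \<le> C"
proof -
  interpret Z: convex_forced \<omega> \<omega>' a b "g 0" "dg 0" \<gamma>m \<gamma>p by (rule map) simp
  define K where "K = {0..1::real} \<times> region \<gamma>m \<gamma>p"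
  have K: "compact K" unfolding K_def by (intro compact_Times compact_Icc Z.compact_region)
  have "K \<subseteq> {0..1} \<times> UNIV \<times> {a..b}" unfolding K_def by (intro Sigma_mono Z.region_subset order_refl)
  with dg_joint have d: "continuous_on K (\<lambda>(\<beta>, \<theta>, x). dg \<beta> \<theta> x)" by (rule continuous_on_subset)
  have "continuous_on K (\<lambda>z. ln (case z of (\<beta>, \<theta>, x) \<Rightarrow> dg \<beta> \<theta> x))"
  proof (intro continuous_on_ln d ballI)
    fix z assume "z \<in> K"
    then obtain \<beta> \<theta> x where z: "z = (\<beta>, \<theta>, x)" "\<beta> \<in> {0..1}" "\<gamma>m \<theta> \<le> x" "x \<le> \<gamma>p \<theta>"
      by (auto simp: K_def region_def)
    show "(case z of (\<beta>, \<theta>, x) \<Rightarrow> dg \<beta> \<theta> x) \<noteq> 0"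
      using convex_forced.dg_pos[OF map[OF z(2)] z(3,4)] by (simp add: z(1))
  qed
  from compact_abs_bound[OF K this] show ?thesis
    by (fastforce simp: K_def region_def)
qed

text \<open>
  Approach the parameter from below. For smaller parameters the extremal graphs are strictly
  separated, so the exponents have the strict sign. As the parameter increases to \<open>\<beta>\<close>, the
  lower graphs increase and the upper graphs decrease; the limits are invariant graphs for \<open>\<beta>\<close>,
  squeezed between the approximants and the extremal graphs at \<open>\<beta>\<close>, hence by extremality equal
  to the latter. Dominated convergence then carries the weak sign over to the limit.
\<close>

lemma lyapunov_limit_signs:
  assumes \<beta>: "\<beta> \<in> feasible" "0 < \<beta>" and inv: "invariant_measure \<omega> \<mu>"
  shows "(\<integral>\<theta>. ln (dg \<beta> \<theta> (\<Phi>m \<beta> \<theta>)) \<partial>\<mu>) \<le> 0" "0 \<le> (\<integral>\<theta>. ln (dg \<beta> \<theta> (\<Phi>p \<beta> \<theta>)) \<partial>\<mu>)"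
proof -
  interpret P: convex_forced_bounded \<omega> \<omega>' a b "g \<beta>" "dg \<beta>" \<gamma>m \<gamma>p by (rule bounded[OF \<beta>(1)])
  interpret prob_space \<mu> using inv by (simp add: invariant_measure_def)
  have sets: "sets \<mu> = sets borel" using inv by (simp add: invariant_measure_def)
  define s where "s k = \<beta> - \<beta> * inverse (real (Suc k))" for k
  have s01: "s k \<in> {0..1}" and s_less: "s k < \<beta>" and s_mono: "s k < s (Suc k)" for k
  proof -
    have i: "0 < inverse (real (Suc k))" "inverse (real (Suc k)) \<le> 1"
      "inverse (real (Suc (Suc k))) < inverse (real (Suc k))"
      by (simp_all add: inverse_le_1_iff)
    have "\<beta> * inverse (real (Suc k)) \<le> \<beta>" using i \<beta>(2) by (simp only: mult_left_le)
    moreover have "\<beta> \<le> 1" using feasible_unit[OF \<beta>(1)] by simp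
    ultimately show "s k \<in> {0..1}" "s k < \<beta>"
      using mult_pos_pos[OF \<beta>(2) i(1)] unfolding s_def atLeastAtMost_iff by linarith+
    show "s k < s (Suc k)"
      using mult_strict_left_mono[OF i(3) \<beta>(2)] unfolding s_def by simp
  qed
  have s_lim: "s \<longlonglongrightarrow> \<beta>"
    using tendsto_diff[OF tendsto_const tendsto_mult[OF tendsto_const LIMSEQ_inverse_real_of_nat]]
    unfolding s_def by fastforce
  have s_feas: "s k \<in> feasible" for k
    by (rule strict_supersolution_below_feasible(1)[OF s01 \<beta>(1) s_less])
  interpret S: convex_forced_bounded \<omega> \<omega>' a b "g (s k)" "dg (s k)" \<gamma>m \<gamma>p for k
    by (rule bounded[OF s_feas])
  have ev: "\<forall>\<^sub>F k in sequentially. s k \<in> {0..1} \<and> u k \<in> {a..b}"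
    if "\<And>k. u k \<in> {a..b}" for u :: "nat \<Rightarrow> real"
    using s01 that by simp
  have lim_m: "(\<lambda>k. \<Phi>m (s k) \<theta>) \<longlonglongrightarrow> \<Phi>m \<beta> \<theta>" for \<theta>
  proof -
    have inc: "incseq (\<lambda>k. \<Phi>m (s k) \<eta>)" for \<eta>
      by (intro incseq_SucI less_imp_le subcritical(3) s01 s_feas s_mono)
    have le: "\<Phi>m (s k) \<eta> \<le> \<Phi>m \<beta> \<eta>" for k \<eta>
      by (intro less_imp_le subcritical(3) s01 s_less \<beta>(1))
    define L where "L \<eta> = (SUP k. \<Phi>m (s k) \<eta>)" for \<eta>
    have L: "(\<lambda>k. \<Phi>m (s k) \<eta>) \<longlonglongrightarrow> L \<eta>" for \<eta>
      unfolding L_def by (rule LIMSEQ_incseq_SUP[OF bdd_aboveI2 inc]) (rule le)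
    have L_le: "L \<eta> \<le> \<Phi>m \<beta> \<eta>" for \<eta>
      by (rule LIMSEQ_le_const2[OF L]) (use le in blast)
    have L_ge: "\<gamma>m \<eta> \<le> L \<eta>" for \<eta>
      by (rule LIMSEQ_le_const[OF L]) (use S.\<gamma>m_le_lower_graph in blast)
    have L_le': "L \<eta> \<le> \<gamma>p \<eta>" for \<eta> using L_le P.lower_graph_le_\<gamma>p by (rule order_trans)
    have L_inv: "g \<beta> \<eta> (L \<eta>) = L (\<omega> \<eta>)" for \<eta>
    proof (rule LIMSEQ_unique)
      show "(\<lambda>k. g (s k) \<eta> (\<Phi>m (s k) \<eta>)) \<longlonglongrightarrow> g \<beta> \<eta> (L \<eta>)"
        by (intro tendsto_joint[OF g_joint s_lim L] ev S.lower_graph_in feasible_unit \<beta>(1)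
            P.in_range[OF L_ge L_le'])
      show "(\<lambda>k. g (s k) \<eta> (\<Phi>m (s k) \<eta>)) \<longlonglongrightarrow> L (\<omega> \<eta>)"
        unfolding S.lower_graph_invariant by (rule L)
    qed
    have "Super \<beta> 0 L" by (simp add: supersolution_def L_ge L_le' L_inv)
    then have "\<Phi>m \<beta> \<theta> \<le> L \<theta>" using P.lower_graph_le_supersolution by blast
    then show ?thesis using L[of \<theta>] L_le[of \<theta>] by simp
  qed
  have lim_p: "(\<lambda>k. \<Phi>p (s k) \<theta>) \<longlonglongrightarrow> \<Phi>p \<beta> \<theta>" for \<theta>
  proof -
    have dec: "decseq (\<lambda>k. \<Phi>p (s k) \<eta>)" for \<eta>
      by (intro decseq_SucI less_imp_le subcritical(4) s01 s_feas s_mono)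
    have ge: "\<Phi>p \<beta> \<eta> \<le> \<Phi>p (s k) \<eta>" for k \<eta>
      by (intro less_imp_le subcritical(4) s01 s_less \<beta>(1))
    define L where "L \<eta> = (INF k. \<Phi>p (s k) \<eta>)" for \<eta>
    have L: "(\<lambda>k. \<Phi>p (s k) \<eta>) \<longlonglongrightarrow> L \<eta>" for \<eta>
      unfolding L_def by (rule LIMSEQ_decseq_INF[OF bdd_belowI2 dec]) (rule ge)
    have L_ge: "\<Phi>p \<beta> \<eta> \<le> L \<eta>" for \<eta>
      by (rule LIMSEQ_le_const[OF L]) (use ge in blast)
    have L_ge': "\<gamma>m \<eta> \<le> L \<eta>" for \<eta> using P.\<gamma>m_le_upper_graph L_ge by (rule order_trans)
    have L_le: "L \<eta> \<le> \<gamma>p \<eta>" for \<eta>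
      by (rule LIMSEQ_le_const2[OF L]) (use S.upper_graph_le_\<gamma>p in blast)
    have L_inv: "g \<beta> \<eta> (L \<eta>) = L (\<omega> \<eta>)" for \<eta>
    proof (rule LIMSEQ_unique)
      show "(\<lambda>k. g (s k) \<eta> (\<Phi>p (s k) \<eta>)) \<longlonglongrightarrow> g \<beta> \<eta> (L \<eta>)"
        by (intro tendsto_joint[OF g_joint s_lim L] ev S.upper_graph_in feasible_unit \<beta>(1)
            P.in_range[OF L_ge' L_le])
      show "(\<lambda>k. g (s k) \<eta> (\<Phi>p (s k) \<eta>)) \<longlonglongrightarrow> L (\<omega> \<eta>)"
        unfolding S.upper_graph_invariant by (rule L)
    qed
    have "Super \<beta> 0 L" by (simp add: supersolution_def L_ge' L_le L_inv)
    then have "L \<theta> \<le> \<Phi>p \<beta> \<theta>" using P.supersolution_le_upper_graph by blast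
    then show ?thesis using L[of \<theta>] L_ge[of \<theta>] by simp
  qed
  obtain C where C: "\<And>\<beta> \<theta> x. \<beta> \<in> {0..1} \<Longrightarrow> \<gamma>m \<theta> \<le> x \<Longrightarrow> x \<le> \<gamma>p \<theta> \<Longrightarrow> \<bar>ln (dg \<beta> \<theta> x)\<bar> \<le> C"
    using ln_dg_uniform_bound by blast
  have meas: "(\<lambda>\<theta>. ln (w \<theta>)) \<in> borel_measurable \<mu>"
    if "w \<in> borel_measurable borel" for w :: "'a \<Rightarrow> real"
    using borel_measurable_ln[OF that] measurable_cong_sets[OF sets refl] by blast
  have less: "AE \<theta> in \<mu>. \<Phi>m (s k) \<theta> < \<Phi>p (s k) \<theta>" for k
    by (intro always_eventually allI subcritical(5)[OF s01 \<beta>(1) s_less])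
  have "(\<lambda>k. \<integral>\<theta>. ln (dg (s k) \<theta> (\<Phi>m (s k) \<theta>)) \<partial>\<mu>) \<longlonglongrightarrow> (\<integral>\<theta>. ln (dg \<beta> \<theta> (\<Phi>m \<beta> \<theta>)) \<partial>\<mu>)"
  proof (rule integral_dominated_convergence[where w = "\<lambda>_. C"])
    show "AE \<theta> in \<mu>. (\<lambda>k. ln (dg (s k) \<theta> (\<Phi>m (s k) \<theta>))) \<longlonglongrightarrow> ln (dg \<beta> \<theta> (\<Phi>m \<beta> \<theta>))"
    proof (intro always_eventually allI tendsto_ln)
      fix \<theta>
      show "(\<lambda>k. dg (s k) \<theta> (\<Phi>m (s k) \<theta>)) \<longlonglongrightarrow> dg \<beta> \<theta> (\<Phi>m \<beta> \<theta>)"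
        by (intro tendsto_joint[OF dg_joint s_lim lim_m] ev S.lower_graph_in feasible_unit \<beta>(1)
            P.lower_graph_in)
      show "dg \<beta> \<theta> (\<Phi>m \<beta> \<theta>) \<noteq> 0"
        using P.dg_pos[OF P.\<gamma>m_le_lower_graph P.lower_graph_le_\<gamma>p, of \<theta>] by simp
    qed
    show "AE \<theta> in \<mu>. norm (ln (dg (s k) \<theta> (\<Phi>m (s k) \<theta>))) \<le> C" for k
      unfolding real_norm_def
      by (intro always_eventually allI C s01 S.\<gamma>m_le_lower_graph S.lower_graph_le_\<gamma>p)
  qed (intro meas P.dg_lower_graph_measurable S.dg_lower_graph_measurable integrable_const)+
  then show "(\<integral>\<theta>. ln (dg \<beta> \<theta> (\<Phi>m \<beta> \<theta>)) \<partial>\<mu>) \<le> 0"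
    by (rule LIMSEQ_le_const2) (use S.lyapunov_signs(1)[OF inv less] less_imp_le in blast)
  have "(\<lambda>k. \<integral>\<theta>. ln (dg (s k) \<theta> (\<Phi>p (s k) \<theta>)) \<partial>\<mu>) \<longlonglongrightarrow> (\<integral>\<theta>. ln (dg \<beta> \<theta> (\<Phi>p \<beta> \<theta>)) \<partial>\<mu>)"
  proof (rule integral_dominated_convergence[where w = "\<lambda>_. C"])
    show "AE \<theta> in \<mu>. (\<lambda>k. ln (dg (s k) \<theta> (\<Phi>p (s k) \<theta>))) \<longlonglongrightarrow> ln (dg \<beta> \<theta> (\<Phi>p \<beta> \<theta>))"
    proof (intro always_eventually allI tendsto_ln)
      fix \<theta>
      show "(\<lambda>k. dg (s k) \<theta> (\<Phi>p (s k) \<theta>)) \<longlonglongrightarrow> dg \<beta> \<theta> (\<Phi>p \<beta> \<theta>)"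
        by (intro tendsto_joint[OF dg_joint s_lim lim_p] ev S.upper_graph_in feasible_unit \<beta>(1)
            P.upper_graph_in)
      show "dg \<beta> \<theta> (\<Phi>p \<beta> \<theta>) \<noteq> 0"
        using P.dg_pos[OF P.\<gamma>m_le_upper_graph P.upper_graph_le_\<gamma>p, of \<theta>] by simp
    qed
    show "AE \<theta> in \<mu>. norm (ln (dg (s k) \<theta> (\<Phi>p (s k) \<theta>))) \<le> C" for k
      unfolding real_norm_def
      by (intro always_eventually allI C s01 S.\<gamma>m_le_upper_graph S.upper_graph_le_\<gamma>p)
  qed (intro meas P.dg_upper_graph_measurable S.dg_upper_graph_measurable integrable_const)+
  then show "0 \<le> (\<integral>\<theta>. ln (dg \<beta> \<theta> (\<Phi>p \<beta> \<theta>)) \<partial>\<mu>)"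
    by (rule LIMSEQ_le_const) (use S.lyapunov_signs(2)[OF inv less] less_imp_le in blast)
qed

text \<open>
  Where the two graphs agree almost everywhere their exponents agree, and this common value is
  both nonpositive and nonnegative.
\<close>

lemma lyapunov_zero_if_pinched:
  assumes \<beta>: "\<beta> \<in> feasible" "0 < \<beta>" and inv: "invariant_measure \<omega> \<mu>"
    and eq: "AE \<theta> in \<mu>. \<Phi>m \<beta> \<theta> = \<Phi>p \<beta> \<theta>"
  shows "(\<integral>\<theta>. ln (dg \<beta> \<theta> (\<Phi>m \<beta> \<theta>)) \<partial>\<mu>) = 0" "(\<integral>\<theta>. ln (dg \<beta> \<theta> (\<Phi>p \<beta> \<theta>)) \<partial>\<mu>) = 0"
proof -
  interpret P: convex_forced_bounded \<omega> \<omega>' a b "g \<beta>" "dg \<beta>" \<gamma>m \<gamma>p by (rule bounded[OF \<beta>(1)])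
  have sets: "sets \<mu> = sets borel" using inv by (simp add: invariant_measure_def)
  have meas: "(\<lambda>\<theta>. ln (w \<theta>)) \<in> borel_measurable \<mu>"
    if "w \<in> borel_measurable borel" for w :: "'a \<Rightarrow> real"
    using borel_measurable_ln[OF that] measurable_cong_sets[OF sets refl] by blast
  have "(\<integral>\<theta>. ln (dg \<beta> \<theta> (\<Phi>m \<beta> \<theta>)) \<partial>\<mu>) = (\<integral>\<theta>. ln (dg \<beta> \<theta> (\<Phi>p \<beta> \<theta>)) \<partial>\<mu>)"
    by (intro integral_cong_AE meas P.dg_lower_graph_measurable P.dg_upper_graph_measurable)
      (use eq in \<open>auto elim: eventually_mono\<close>)
  then show "(\<integral>\<theta>. ln (dg \<beta> \<theta> (\<Phi>m \<beta> \<theta>)) \<partial>\<mu>) = 0" "(\<integral>\<theta>. ln (dg \<beta> \<theta> (\<Phi>p \<beta> \<theta>)) \<partial>\<mu>) = 0"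
    using lyapunov_limit_signs[OF \<beta> inv] by auto
qed

end

section \<open>From derivatives to tangents and monotonicity\<close>

lemma deriv_on_has_derivative:
  assumes "deriv_on S k h differentiable (at x within S)"
  shows "(deriv_on S k h has_real_derivative deriv_on S (Suc k) h x) (at x within S)"
  using assms
  by (simp add: vector_derivative_works has_real_derivative_iff_has_vector_derivative)

lemma mvt_within:
  fixes h :: "real \<Rightarrow> real"
  assumes "x < y" "{x..y} \<subseteq> S"
    and "\<And>z. z \<in> {x..y} \<Longrightarrow> (h has_real_derivative h' z) (at z within S)"
  shows "\<exists>z\<in>{x<..<y}. h y - h x = h' z * (y - x)"
proof (rule mvt_simple[OF assms(1)])
  fix z assume "x \<le> z" "z \<le> y"
  then have "(h has_real_derivative h' z) (at z within {x..y})"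
    using assms(3)[of z] DERIV_subset[OF _ assms(2)] by simp
  then show "(h has_derivative (*) (h' z)) (at z within {x..y})"
    by (simp add: has_field_derivative_def)
qed

text \<open>
  A positive second derivative makes \<open>h'\<close> strictly increasing, and the increment of \<open>h\<close> is a value
  of \<open>h'\<close> strictly between \<open>x\<close> and \<open>y\<close>, times \<open>y - x\<close>. All derivatives are taken within \<open>S\<close>, which
  covers the end points of \<open>S\<close>, where they are one-sided.
\<close>

lemma strict_tangent:
  fixes h :: "real \<Rightarrow> real"
  assumes sub: "{c..d} \<subseteq> S"
    and h: "\<And>z. z \<in> S \<Longrightarrow> (h has_real_derivative h' z) (at z within S)"
    and h': "\<And>z. z \<in> S \<Longrightarrow> (h' has_real_derivative h'' z) (at z within S)"
    and pos: "\<And>z. z \<in> {c..d} \<Longrightarrow> 0 < h'' z"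
    and xy: "x \<in> {c..d}" "y \<in> {c..d}" "x \<noteq> y"
  shows "h x + h' x * (y - x) < h y"
proof -
  have mono: "h' u < h' v" if uv: "u \<in> {c..d}" "v \<in> {c..d}" "u < v" for u v
  proof -
    have "{u..v} \<subseteq> {c..d}" using uv by auto
    then obtain z where "z \<in> {u<..<v}" "h' v - h' u = h'' z * (v - u)"
      using mvt_within[OF uv(3) _ h'] sub by blast
    moreover from this have "0 < h'' z * (v - u)"
      using uv by (intro mult_pos_pos pos) auto
    ultimately show ?thesis by linarith
  qed
  consider "x < y" | "y < x" using xy(3) by linarith
  then show ?thesis
  proof cases
    case 1
    have "{x..y} \<subseteq> {c..d}" using xy by auto
    then obtain z where z: "z \<in> {x<..<y}" "h y - h x = h' z * (y - x)"
      using mvt_within[OF 1 _ h] sub by blast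
    have "h' x < h' z" using z xy by (intro mono) auto
    then have "h' x * (y - x) < h' z * (y - x)" using 1 by simp
    then show ?thesis using z by linarith
  next
    case 2
    have "{y..x} \<subseteq> {c..d}" using xy by auto
    then obtain z where z: "z \<in> {y<..<x}" "h x - h y = h' z * (x - y)"
      using mvt_within[OF 2 _ h] sub by blast
    have "h' z < h' x" using z xy by (intro mono) auto
    then have "h' z * (x - y) < h' x * (x - y)" using 2 by simp
    then show ?thesis using z(2) by (simp add: algebra_simps)
  qed
qed

section \<open>The bifurcation theorem\<close>

theorem theorem6p1:
  fixes \<omega> :: "'a::metric_space \<Rightarrow> 'a"
    and a b :: real
    and X :: "real set"
    and f :: "real \<Rightarrow> 'a \<times> real \<Rightarrow> 'a \<times> real"
    and \<gamma>m \<gamma>p :: "'a \<Rightarrow> real"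
    and \<Gamma> :: "('a \<times> real) set"
  assumes compact: "compact (UNIV :: 'a set)"
    and homeo: "\<exists>\<omega>'. homeomorphism UNIV UNIV \<omega> \<omega>'"
    and X: "X = {a..b}"
    and family: "\<And>\<beta>. \<beta> \<in> {0..1} \<Longrightarrow> forced_monotone_map X 2 \<omega> (f \<beta>)"
    and gamma_cont: "continuous_on UNIV \<gamma>m" "continuous_on UNIV \<gamma>p"
    and gamma_X: "\<And>\<theta>. \<gamma>m \<theta> \<in> X" "\<And>\<theta>. \<gamma>p \<theta> \<in> X"
    and gamma_less: "\<And>\<theta>. \<gamma>m \<theta> < \<gamma>p \<theta>"
    and Gamma: "\<Gamma> = region \<gamma>m \<gamma>p"
    and d1_0: "\<exists>\<phi>1 \<phi>2. continuous_on UNIV \<phi>1 \<and> continuous_on UNIV \<phi>2 \<and>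
        invariant_graph_in \<Gamma> X \<omega> (f 0) \<phi>1 \<and> invariant_graph_in \<Gamma> X \<omega> (f 0) \<phi>2 \<and>
        (\<forall>\<theta>. \<phi>1 \<theta> \<noteq> \<phi>2 \<theta>)"
    and d1_1: "\<not> (\<exists>\<phi>. invariant_graph_in \<Gamma> X \<omega> (f 1) \<phi>)"
    and d2: "\<And>\<beta> \<theta>. \<beta> \<in> {0..1} \<Longrightarrow> fibre (f \<beta>) \<theta> (\<gamma>m \<theta>) \<ge> \<gamma>m (\<omega> \<theta>)"
        "\<And>\<beta> \<theta>. \<beta> \<in> {0..1} \<Longrightarrow> fibre (f \<beta>) \<theta> (\<gamma>p \<theta>) \<ge> \<gamma>p (\<omega> \<theta>)"
    and d3_x: "\<And>i. i \<in> {0, 1, 2} \<Longrightarrow> continuous_on ({0..1} \<times> UNIV \<times> X)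
        (\<lambda>(\<beta>, \<theta>, x). deriv_on X i (fibre (f \<beta>) \<theta>) x)"
    and d3_beta_diff: "\<And>\<beta> \<theta> x. \<beta> \<in> {0..1} \<Longrightarrow> x \<in> X \<Longrightarrow>
        (\<lambda>t. fibre (f t) \<theta> x) differentiable (at \<beta> within {0..1})"
    and d3_beta: "continuous_on ({0..1} \<times> UNIV \<times> X)
        (\<lambda>(\<beta>, \<theta>, x). deriv_on {0..1} 1 (\<lambda>t. fibre (f t) \<theta> x) \<beta>)"
    and d4: "\<And>\<beta> \<theta> x. \<beta> \<in> {0..1} \<Longrightarrow> (\<theta>, x) \<in> \<Gamma> \<Longrightarrow> deriv_on X 1 (fibre (f \<beta>) \<theta>) x > 0"
    and d5: "\<And>\<beta> \<theta> x. \<beta> \<in> {0..1} \<Longrightarrow> (\<theta>, x) \<in> \<Gamma> \<Longrightarrow>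
        deriv_on {0..1} 1 (\<lambda>t. fibre (f t) \<theta> x) \<beta> > 0"
    and d6: "\<And>\<beta> \<theta> x. \<beta> \<in> {0..1} \<Longrightarrow> (\<theta>, x) \<in> \<Gamma> \<Longrightarrow> deriv_on X 2 (fibre (f \<beta>) \<theta>) x > 0"
  shows "\<exists>!\<beta>c. \<beta>c \<in> {0<..<1} \<and>
    (\<forall>\<beta>\<in>{0..1}. \<beta> < \<beta>c \<longrightarrow>
      (\<exists>\<phi>m \<phi>p. continuous_on UNIV \<phi>m \<and> continuous_on UNIV \<phi>p \<and>
        invariant_graph_in \<Gamma> X \<omega> (f \<beta>) \<phi>m \<and> invariant_graph_in \<Gamma> X \<omega> (f \<beta>) \<phi>p \<and>
        (\<forall>\<theta>. \<phi>m \<theta> < \<phi>p \<theta>) \<and>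
        (\<forall>\<mu>. invariant_measure \<omega> \<mu> \<longrightarrow>
           lyapunov_exponent X (f \<beta>) \<mu> \<phi>m < 0 \<and> lyapunov_exponent X (f \<beta>) \<mu> \<phi>p > 0))) \<and>
    ((\<exists>\<phi>. continuous_on UNIV \<phi> \<and> invariant_graph_in \<Gamma> X \<omega> (f \<beta>c) \<phi> \<and>
        (\<forall>\<psi>. invariant_graph_in \<Gamma> X \<omega> (f \<beta>c) \<psi> \<longrightarrow> \<psi> = \<phi>) \<and>
        (\<forall>\<mu>. invariant_measure \<omega> \<mu> \<longrightarrow> lyapunov_exponent X (f \<beta>c) \<mu> \<phi> = 0)) \<or>
     (\<exists>\<phi>m \<phi>p. invariant_graph_in \<Gamma> X \<omega> (f \<beta>c) \<phi>m \<and> invariant_graph_in \<Gamma> X \<omega> (f \<beta>c) \<phi>p \<and>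
        \<phi>m \<noteq> \<phi>p \<and> weakly_pinched \<phi>m \<phi>p \<and>
        (\<forall>\<mu>. invariant_measure \<omega> \<mu> \<longrightarrow>
           ((AE \<theta> in \<mu>. \<phi>m \<theta> = \<phi>p \<theta>) \<longrightarrow>
              lyapunov_exponent X (f \<beta>c) \<mu> \<phi>m = 0 \<and> lyapunov_exponent X (f \<beta>c) \<mu> \<phi>p = 0) \<and>
           ((AE \<theta> in \<mu>. \<phi>m \<theta> < \<phi>p \<theta>) \<longrightarrow>
              lyapunov_exponent X (f \<beta>c) \<mu> \<phi>m < 0 \<and> lyapunov_exponent X (f \<beta>c) \<mu> \<phi>p > 0)))) \<and>
    (\<forall>\<beta>\<in>{0..1}. \<beta> > \<beta>c \<longrightarrow> \<not> (\<exists>\<phi>. invariant_graph_in \<Gamma> X \<omega> (f \<beta>) \<phi>))"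
proof -
  define g where "g = (\<lambda>\<beta>. fibre (f \<beta>))"
  define dg where "dg = (\<lambda>\<beta> \<theta>. deriv_on X 1 (fibre (f \<beta>) \<theta>))"
  obtain \<omega>' where homeo': "homeomorphism UNIV UNIV \<omega> \<omega>'" using homeo by blast
  have forced: "\<beta> \<in> {0..1} \<Longrightarrow> x \<in> X \<Longrightarrow> g \<beta> \<theta> x \<in> X"
    "\<beta> \<in> {0..1} \<Longrightarrow> strict_mono_on X (g \<beta> \<theta>)"
    "\<beta> \<in> {0..1} \<Longrightarrow> k < 2 \<Longrightarrow> x \<in> X \<Longrightarrow> deriv_on X k (g \<beta> \<theta>) differentiable (at x within X)"
    "\<beta> \<in> {0..1} \<Longrightarrow> k \<le> 2 \<Longrightarrow> continuous_on (UNIV \<times> X) (\<lambda>(\<theta>, x). deriv_on X k (g \<beta> \<theta>) x)"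
    for \<beta> \<theta> x k
    using family[of \<beta>] unfolding forced_monotone_map_def g_def by blast+
  have single: "convex_forced \<omega> \<omega>' a b (g \<beta>) (dg \<beta>) \<gamma>m \<gamma>p" if \<beta>: "\<beta> \<in> {0..1}" for \<beta>
  proof
    show "continuous_on (UNIV \<times> {a..b}) (\<lambda>(\<theta>, x). g \<beta> \<theta> x)"
      using forced(4)[OF \<beta>, of 0] by (simp add: X)
    show "continuous_on (UNIV \<times> {a..b}) (\<lambda>(\<theta>, x). dg \<beta> \<theta> x)"
      using forced(4)[OF \<beta>, of 1] by (simp add: X dg_def g_def)
    show "g \<beta> \<theta> x \<in> {a..b}" if "x \<in> {a..b}" for \<theta> x
      using forced(1)[OF \<beta>] that by (simp only: X)
    show "g \<beta> \<theta> x < g \<beta> \<theta> y" if "x \<in> {a..b}" "y \<in> {a..b}" "x < y" for \<theta> x y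
      using strict_mono_onD[OF forced(2)[OF \<beta>]] that by (simp only: X)
    show "0 < dg \<beta> \<theta> x" if "\<gamma>m \<theta> \<le> x" "x \<le> \<gamma>p \<theta>" for \<theta> x
      using d4[OF \<beta>] that by (simp add: dg_def Gamma region_def del: One_nat_def)
    show "g \<beta> \<theta> x + dg \<beta> \<theta> x * (y - x) < g \<beta> \<theta> y"
      if "\<gamma>m \<theta> \<le> x" "x \<le> \<gamma>p \<theta>" "\<gamma>m \<theta> \<le> y" "y \<le> \<gamma>p \<theta>" "x \<noteq> y" for \<theta> x y
    proof (rule strict_tangent[of "\<gamma>m \<theta>" "\<gamma>p \<theta>" X _ _ "deriv_on X 2 (g \<beta> \<theta>)"])
      show "{\<gamma>m \<theta>..\<gamma>p \<theta>} \<subseteq> X" using gamma_X[of \<theta>] by (auto simp: X)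
      show "(g \<beta> \<theta> has_real_derivative dg \<beta> \<theta> z) (at z within X)" if "z \<in> X" for z
        using deriv_on_has_derivative[OF forced(3)[OF \<beta>, of 0 z]] that by (simp add: dg_def g_def)
      show "(dg \<beta> \<theta> has_real_derivative deriv_on X 2 (g \<beta> \<theta>) z) (at z within X)" if "z \<in> X" for z
        using deriv_on_has_derivative[OF forced(3)[OF \<beta>, of 1 z]] that
        by (simp only: dg_def g_def one_less_numeral_iff semiring_norm Suc_1)
      show "0 < deriv_on X 2 (g \<beta> \<theta>) z" if "z \<in> {\<gamma>m \<theta>..\<gamma>p \<theta>}" for z
        unfolding g_def by (rule d6[OF \<beta>]) (use that in \<open>simp add: Gamma region_def\<close>)
    qed (use that in auto)
    show "\<gamma>m (\<omega> \<theta>) \<le> g \<beta> \<theta> (\<gamma>m \<theta>)" "\<gamma>p (\<omega> \<theta>) \<le> g \<beta> \<theta> (\<gamma>p \<theta>)" for \<theta>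
      using d2[OF \<beta>] by (simp_all add: g_def)
  qed (use homeo' compact gamma_cont gamma_X gamma_less in \<open>auto simp: homeomorphism_def X\<close>)
  interpret F: forced_family \<omega> \<omega>' a b g dg \<gamma>m \<gamma>p
  proof (rule forced_family.intro)
    show "continuous_on ({0..1} \<times> UNIV \<times> {a..b}) (\<lambda>(\<beta>, \<theta>, x). g \<beta> \<theta> x)"
      using d3_x[of 0] by (simp add: X g_def)
    show "continuous_on ({0..1} \<times> UNIV \<times> {a..b}) (\<lambda>(\<beta>, \<theta>, x). dg \<beta> \<theta> x)"
      using d3_x[of 1] by (simp add: X dg_def)
    show "g \<beta> \<theta> x < g \<beta>' \<theta> x"
      if \<beta>: "\<beta> \<in> {0..1}" "\<beta>' \<in> {0..1}" "\<beta> < \<beta>'" and x: "\<gamma>m \<theta> \<le> x" "x \<le> \<gamma>p \<theta>" for \<beta> \<beta>' \<theta> x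
    proof -
      have xX: "x \<in> X" using x gamma_X[of \<theta>] by (auto simp: X)
      have "((\<lambda>t. g t \<theta> x) has_real_derivative deriv_on {0..1} 1 (\<lambda>t. g t \<theta> x) z) (at z within {0..1})"
        if "z \<in> {0..1}" for z
        using deriv_on_has_derivative[of "{0..1}" 0 "\<lambda>t. g t \<theta> x" z] d3_beta_diff[OF that xX, of \<theta>]
        by (simp add: g_def)
      moreover have "{\<beta>..\<beta>'} \<subseteq> {0..1}" using \<beta> by auto
      ultimately obtain z where z: "z \<in> {\<beta><..<\<beta>'}"
        "g \<beta>' \<theta> x - g \<beta> \<theta> x = deriv_on {0..1} 1 (\<lambda>t. g t \<theta> x) z * (\<beta>' - \<beta>)"
        using mvt_within[OF \<beta>(3), of "{0..1}" "\<lambda>t. g t \<theta> x"] by blast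
      have "0 < deriv_on {0..1} 1 (\<lambda>t. g t \<theta> x) z"
        unfolding g_def by (rule d5) (use z \<beta> x in \<open>auto simp: Gamma region_def\<close>)
      then have "0 < deriv_on {0..1} 1 (\<lambda>t. g t \<theta> x) z * (\<beta>' - \<beta>)"
        by (rule mult_pos_pos) (use \<beta>(3) in simp)
      then show ?thesis unfolding z(2)[symmetric] by simp
    qed
  qed (rule single)

  have graph_iff: "invariant_graph_in \<Gamma> X \<omega> (f \<beta>) \<phi> \<longleftrightarrow>
      \<phi> \<in> borel_measurable borel \<and> (\<forall>\<theta>. \<gamma>m \<theta> \<le> \<phi> \<theta> \<and> \<phi> \<theta> \<le> \<gamma>p \<theta> \<and> g \<beta> \<theta> (\<phi> \<theta>) = \<phi> (\<omega> \<theta>))" for \<beta> \<phi>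
    using gamma_X unfolding invariant_graph_in_def invariant_graph_def Gamma region_def g_def X
    by (auto intro: order_trans)
  have lyap: "lyapunov_exponent X (f \<beta>) \<mu> \<phi> = (\<integral>\<theta>. ln (dg \<beta> \<theta> (\<phi> \<theta>)) \<partial>\<mu>)" for \<beta> \<mu> \<phi>
    by (simp only: lyapunov_exponent_def dg_def)
  have graphs: "invariant_graph_in \<Gamma> X \<omega> (f \<beta>) (F.\<Phi>m \<beta>)" "invariant_graph_in \<Gamma> X \<omega> (f \<beta>) (F.\<Phi>p \<beta>)"
    if \<beta>: "\<beta> \<in> F.feasible" for \<beta>
  proof -
    interpret P: convex_forced_bounded \<omega> \<omega>' a b "g \<beta>" "dg \<beta>" \<gamma>m \<gamma>p by (rule F.bounded[OF \<beta>])
    show "invariant_graph_in \<Gamma> X \<omega> (f \<beta>) (F.\<Phi>m \<beta>)" "invariant_graph_in \<Gamma> X \<omega> (f \<beta>) (F.\<Phi>p \<beta>)"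
      unfolding graph_iff
      by (simp_all add: P.lower_graph_measurable P.\<gamma>m_le_lower_graph P.lower_graph_le_\<gamma>p
          P.lower_graph_invariant P.upper_graph_measurable P.\<gamma>m_le_upper_graph
          P.upper_graph_le_\<gamma>p P.upper_graph_invariant)
  qed
  have graph_super: "F.Super \<beta> 0 \<phi>" if "invariant_graph_in \<Gamma> X \<omega> (f \<beta>) \<phi>" for \<beta> \<phi>
    using that unfolding graph_iff supersolution_def by auto
  have graph_feasible: "\<beta> \<in> F.feasible" if "\<beta> \<in> {0..1}" "invariant_graph_in \<Gamma> X \<omega> (f \<beta>) \<phi>" for \<beta> \<phi>
    using F.feasible_if_supersolution[OF that(1) graph_super[OF that(2)]] by simp

  obtain \<phi>1 \<phi>2 where \<phi>12: "continuous_on UNIV \<phi>1" "continuous_on UNIV \<phi>2"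
    "invariant_graph_in \<Gamma> X \<omega> (f 0) \<phi>1" "invariant_graph_in \<Gamma> X \<omega> (f 0) \<phi>2" "\<And>\<theta>. \<phi>1 \<theta> \<noteq> \<phi>2 \<theta>"
    using d1_0 by blast
  have zero: "0 \<in> F.feasible" using graph_feasible[OF _ \<phi>12(3)] by simp
  have one: "1 \<notin> F.feasible" using graphs(1) d1_1 by blast
  define \<beta>c where "\<beta>c = F.critical"
  have crit: "\<beta>c \<in> F.feasible" unfolding \<beta>c_def using F.critical_feasible zero by blast
  have crit_le1: "\<beta>c < 1"
    using F.feasible_unit[OF crit] crit one by (cases "\<beta>c = 1") auto
  (* The average of the two disjoint graphs at parameter 0 is a strict supersolution, whichever of
     them is the upper one over a given base point. *)
  have crit_pos: "0 < \<beta>c"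
  proof -
    have "continuous_on UNIV (\<lambda>\<theta>. \<bar>\<phi>1 \<theta> - \<phi>2 \<theta>\<bar>)"
      by (intro continuous_intros \<phi>12)
    from compact_positive_bound[OF compact this]
    obtain \<delta> where \<delta>: "0 < \<delta>" "\<And>\<theta>. \<delta> \<le> \<bar>\<phi>1 \<theta> - \<phi>2 \<theta>\<bar>" using \<phi>12(5) by auto
    interpret P: convex_forced \<omega> \<omega>' a b "g 0" "dg 0" \<gamma>m \<gamma>p by (rule single) simp
    have "\<exists>c>0. F.Super 0 c (\<lambda>\<theta>. (\<phi>1 \<theta> + \<phi>2 \<theta>) / 2)"
      using \<phi>12(3,4) unfolding graph_iff by (intro P.midpoint_supersolution[OF _ _ _ _ _ _ \<delta>]) auto
    then obtain \<beta> where "\<beta> \<in> F.feasible" "0 < \<beta>"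
      using F.feasible_beyond_strict_supersolution[of 0] by auto
    then show ?thesis using F.le_critical unfolding \<beta>c_def by fastforce
  qed

  have below: "\<exists>\<phi>m \<phi>p. continuous_on UNIV \<phi>m \<and> continuous_on UNIV \<phi>p \<and>
      invariant_graph_in \<Gamma> X \<omega> (f \<beta>) \<phi>m \<and> invariant_graph_in \<Gamma> X \<omega> (f \<beta>) \<phi>p \<and>
      (\<forall>\<theta>. \<phi>m \<theta> < \<phi>p \<theta>) \<and>
      (\<forall>\<mu>. invariant_measure \<omega> \<mu> \<longrightarrow>
         lyapunov_exponent X (f \<beta>) \<mu> \<phi>m < 0 \<and> lyapunov_exponent X (f \<beta>) \<mu> \<phi>p > 0)"
    if \<beta>: "\<beta> \<in> {0..1}" "\<beta> < \<beta>c" for \<beta>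
  proof -
    have feas: "\<beta> \<in> F.feasible"
      by (rule F.strict_supersolution_below_feasible(1)[OF \<beta>(1) crit \<beta>(2)])
    interpret P: convex_forced_bounded \<omega> \<omega>' a b "g \<beta>" "dg \<beta>" \<gamma>m \<gamma>p by (rule F.bounded[OF feas])
    note sub = F.subcritical[OF \<beta>(1) crit \<beta>(2)]
    have "lyapunov_exponent X (f \<beta>) \<mu> (F.\<Phi>m \<beta>) < 0 \<and> lyapunov_exponent X (f \<beta>) \<mu> (F.\<Phi>p \<beta>) > 0"
      if "invariant_measure \<omega> \<mu>" for \<mu>
      unfolding lyap using P.lyapunov_signs[OF that] sub(5) by simp
    then show ?thesis using sub(1,2,5) graphs[OF feas] by blast
  qed

  interpret C: convex_forced_bounded \<omega> \<omega>' a b "g \<beta>c" "dg \<beta>c" \<gamma>m \<gamma>p by (rule F.bounded[OF crit])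
  have pinched_zero: "lyapunov_exponent X (f \<beta>c) \<mu> (F.\<Phi>m \<beta>c) = 0 \<and>
      lyapunov_exponent X (f \<beta>c) \<mu> (F.\<Phi>p \<beta>c) = 0"
    if "invariant_measure \<omega> \<mu>" "AE \<theta> in \<mu>. F.\<Phi>m \<beta>c \<theta> = F.\<Phi>p \<beta>c \<theta>" for \<mu>
    unfolding lyap using F.lyapunov_zero_if_pinched[OF crit crit_pos that] by simp
  have at: "(\<exists>\<phi>. continuous_on UNIV \<phi> \<and> invariant_graph_in \<Gamma> X \<omega> (f \<beta>c) \<phi> \<and>
        (\<forall>\<psi>. invariant_graph_in \<Gamma> X \<omega> (f \<beta>c) \<psi> \<longrightarrow> \<psi> = \<phi>) \<and>
        (\<forall>\<mu>. invariant_measure \<omega> \<mu> \<longrightarrow> lyapunov_exponent X (f \<beta>c) \<mu> \<phi> = 0)) \<or>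
     (\<exists>\<phi>m \<phi>p. invariant_graph_in \<Gamma> X \<omega> (f \<beta>c) \<phi>m \<and> invariant_graph_in \<Gamma> X \<omega> (f \<beta>c) \<phi>p \<and>
        \<phi>m \<noteq> \<phi>p \<and> weakly_pinched \<phi>m \<phi>p \<and>
        (\<forall>\<mu>. invariant_measure \<omega> \<mu> \<longrightarrow>
           ((AE \<theta> in \<mu>. \<phi>m \<theta> = \<phi>p \<theta>) \<longrightarrow>
              lyapunov_exponent X (f \<beta>c) \<mu> \<phi>m = 0 \<and> lyapunov_exponent X (f \<beta>c) \<mu> \<phi>p = 0) \<and>
           ((AE \<theta> in \<mu>. \<phi>m \<theta> < \<phi>p \<theta>) \<longrightarrow>
              lyapunov_exponent X (f \<beta>c) \<mu> \<phi>m < 0 \<and> lyapunov_exponent X (f \<beta>c) \<mu> \<phi>p > 0)))"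
  proof (cases "F.\<Phi>m \<beta>c = F.\<Phi>p \<beta>c")
    case True
    (* The common graph is both lower and upper semicontinuous. *)
    have "continuous_on UNIV (F.\<Phi>m \<beta>c)"
      using C.lower_graph_lsc C.upper_graph_usc True by (intro continuous_if_semicont) simp_all
    moreover have "\<psi> = F.\<Phi>m \<beta>c" if \<psi>: "invariant_graph_in \<Gamma> X \<omega> (f \<beta>c) \<psi>" for \<psi>
    proof
      fix \<theta>
      have "F.\<Phi>m \<beta>c \<theta> \<le> \<psi> \<theta>" "\<psi> \<theta> \<le> F.\<Phi>p \<beta>c \<theta>"
        using C.lower_graph_le_supersolution C.supersolution_le_upper_graph graph_super[OF \<psi>]
        by blast+
      then show "\<psi> \<theta> = F.\<Phi>m \<beta>c \<theta>" using True by simp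
    qed
    moreover have "lyapunov_exponent X (f \<beta>c) \<mu> (F.\<Phi>m \<beta>c) = 0" if "invariant_measure \<omega> \<mu>" for \<mu>
      using pinched_zero[OF that] True by simp
    ultimately show ?thesis using graphs(1)[OF crit] by blast
  next
    case False
    have "weakly_pinched (F.\<Phi>m \<beta>c) (F.\<Phi>p \<beta>c)"
      unfolding weakly_pinched_def
      using C.lower_le_upper C.lower_graph_lsc C.upper_graph_usc
        F.critical_gap_zero[folded \<beta>c_def, OF crit crit_le1] by blast
    moreover have "lyapunov_exponent X (f \<beta>c) \<mu> (F.\<Phi>m \<beta>c) < 0 \<and> lyapunov_exponent X (f \<beta>c) \<mu> (F.\<Phi>p \<beta>c) > 0"
      if "invariant_measure \<omega> \<mu>" "AE \<theta> in \<mu>. F.\<Phi>m \<beta>c \<theta> < F.\<Phi>p \<beta>c \<theta>" for \<mu>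
      unfolding lyap using C.lyapunov_signs[OF that] by simp
    ultimately show ?thesis using False pinched_zero graphs[OF crit] by blast
  qed

  have above: "\<not> (\<exists>\<phi>. invariant_graph_in \<Gamma> X \<omega> (f \<beta>) \<phi>)" if "\<beta> \<in> {0..1}" "\<beta> > \<beta>c" for \<beta>
    using graph_feasible[OF that(1)] F.le_critical that(2) unfolding \<beta>c_def by fastforce

  (* The second and third clauses already determine the parameter: an invariant graph exists
     strictly below it and none exists strictly above it. *)
  have unique: "\<beta> = \<beta>c"
    if \<beta>: "\<beta> \<in> {0<..<1}"
      and ex: "\<forall>\<beta>'\<in>{0..1}. \<beta>' < \<beta> \<longrightarrow> (\<exists>\<phi>. invariant_graph_in \<Gamma> X \<omega> (f \<beta>') \<phi>)"
      and none: "\<forall>\<beta>'\<in>{0..1}. \<beta>' > \<beta> \<longrightarrow> \<not> (\<exists>\<phi>. invariant_graph_in \<Gamma> X \<omega> (f \<beta>') \<phi>)" for \<beta>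
  proof (rule linorder_cases[of \<beta> \<beta>c])
    assume "\<beta> < \<beta>c"
    then show ?thesis using none F.feasible_unit[OF crit] graphs(1)[OF crit] by blast
  next
    assume "\<beta>c < \<beta>"
    define \<beta>' where "\<beta>' = (\<beta>c + \<beta>) / 2"
    have "\<beta>' \<in> {0..1}" "\<beta>' < \<beta>" "\<beta>c < \<beta>'"
      using \<beta> crit_pos \<open>\<beta>c < \<beta>\<close> by (auto simp: \<beta>'_def)
    then show ?thesis using ex above by blast
  qed
  show ?thesis
    apply (rule ex1I[of _ \<beta>c])
     apply (intro conjI ballI impI)
        apply (use crit_pos crit_le1 in simp)
       apply (erule (1) below)
      apply (rule at)
     apply (erule (1) above)
    apply (elim conjE)
    apply (erule unique)
     apply blast
    apply assumption
    done
qed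

end
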